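(* Let $k,m\ge1$ and $0\le d\le km$. We have the orthogonal decomposition $$\Lambda^d(\mathbb R^k\otimes\mathbb R^m)=\bigoplus_\lambda V_\lambda,$$ where the sum runs over all Young diagrams $\lambda\subseteq[k]\times[m]$ with $d$ boxes.
   Context: $\mathbb R^k\otimes\mathbb R^m$ has the standard Euclidean inner product and the tensor action of $\mathrm O(k)\times\mathrm O(m)$; $\Lambda^d(\mathbb R^k\otimes\mathbb R^m)$ has the induced action and inner product $\langle w_1\wedge\dots\wedge w_d,w_1'\wedge\dots\wedge w_d'\rangle=\det[\langle w_i,w_j'\rangle]$. A Young diagram $\lambda\subseteq[k]\times[m]$ (partition with at most $k$ parts, all at most $m$) is identified with its set of boxes $(i,j)$, $j\le\lambda_i$. Put $v_\lambda=\bigwedge_{(i,j)\in\lambda}e_i\otimes f_j$, with $(e_i)$, $(f_j)$ the standard bases of $\mathbb R^k,\mathbb R^m$ (defined up to sign). The Schubert span $V_\lambda\subseteq\Lambda^d(\mathbb R^k\otimes\mathbb R^m)$, $d=|\lambda|$, is the linear span of the Schubert zonoid $K_\lambda$ associated with the real Schubert variety $\Omega_\lambda\subseteq G(k,m)$; equivalently (and this may be taken as the definition), $V_\lambda$ is the real linear span of the $\mathrm O(k)\times\mathrm O(m)$-orbit of $v_\lambda$. *)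

theory Defs
  imports "HOL-Analysis.Analysis" "Jordan_Normal_Form.Determinant"
begin

no_notation Matrix.vec_index (infixl "$" 100)

section \<open>Exterior powers of Euclidean space\<close>

text \<open>
  The exterior algebra of \<open>real ^ 'n\<close> is \<open>real ^ ('n set)\<close>: the coordinate at \<open>S\<close> is the
  coefficient of the basis vector \<open>e\<^sub>S\<close>, the wedge of the \<open>e\<^sub>s\<close> with \<open>s \<in> S\<close> in the order of
  \<open>basis_list S\<close>. That order is an arbitrary choice; another choice changes \<open>e\<^sub>S\<close> only by a sign.
\<close>

definition basis_list :: "'n::finite set \<Rightarrow> 'n list" where
  "basis_list S = (SOME xs. distinct xs \<and> set xs = S)"

definition ext_power :: "nat \<Rightarrow> (real ^ ('n::finite set)) set" where
  "ext_power d = {x. \<forall>S. x $ S \<noteq> 0 \<longrightarrow> card S = d}"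

text \<open>The coordinates of a decomposable vector are the maximal minors of its factors.\<close>

definition wedge :: "(real ^ 'n::finite) list \<Rightarrow> real ^ ('n set)" where
  "wedge ws = (\<chi> S. if card S = length ws
     then Determinant.det (Matrix.mat (length ws) (length ws) (\<lambda>(i, j). ws ! i $ (basis_list S ! j)))
     else 0)"

text \<open>The induced map: the linear map with \<open>e\<^sub>S \<mapsto> A e\<^sub>s\<^sub>1 \<and> \<dots> \<and> A e\<^sub>s\<^sub>d\<close>, where
  \<open>basis_list S = [s\<^sub>1, \<dots>, s\<^sub>d]\<close>.\<close>

definition ext_map :: "real ^ 'n ^ 'n \<Rightarrow> real ^ ('n::finite set) \<Rightarrow> real ^ ('n set)" where
  "ext_map A x = (\<Sum>S\<in>UNIV. (x $ S) *\<^sub>R wedge (map (\<lambda>s. A *v axis s 1) (basis_list S)))"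

lemma basis_list:
  shows distinct_basis_list: "distinct (basis_list S)"
    and set_basis_list: "set (basis_list S) = S"
    and length_basis_list: "length (basis_list S) = card S"
proof -
  have "\<exists>xs. distinct xs \<and> set xs = S"
    using finite_distinct_list[of S] by auto
  from someI_ex[OF this] show 1: "distinct (basis_list S)" and 2: "set (basis_list S) = S"
    by (auto simp: basis_list_def)
  show "length (basis_list S) = card S"
    using 1 2 distinct_card by metis
qed

lemma subspace_ext_power: "subspace (ext_power d)"
proof (rule subspaceI)
  fix x y :: "real ^ ('n::finite set)"
  assume "x \<in> ext_power d" "y \<in> ext_power d"
  then show "x + y \<in> ext_power d" unfolding ext_power_def mem_Collect_eq
    by (metis add.right_neutral vector_add_component)
qed (auto simp: ext_power_def)

lemma wedge_in_ext_power: "wedge ws \<in> ext_power (length ws)"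
  by (simp add: wedge_def ext_power_def)

lemma det_rows_expand:
  fixes c :: "nat \<Rightarrow> 'n::finite \<Rightarrow> real"
  shows "Determinant.det (Matrix.mat d d (\<lambda>(i, j). \<Sum>n\<in>UNIV. c i n * r n j)) =
    (\<Sum>f\<in>PiE {0..<d} (\<lambda>_. UNIV). (\<Prod>i=0..<d. c i (f i)) *
       Determinant.det (Matrix.mat d d (\<lambda>(i, j). r (f i) j)))"
proof -
  have det: "Determinant.det (Matrix.mat d d (\<lambda>(i, j). g i j)) =
      (\<Sum>p | p permutes {0..<d}. signof p * (\<Prod>i=0..<d. g i (p i)))" for g :: "nat \<Rightarrow> nat \<Rightarrow> real"
    by (subst Determinant.det_def'[of _ d])
       (auto intro!: sum.cong prod.cong simp: permutes_in_image)
  have "(\<Prod>i=0..<d. \<Sum>n\<in>UNIV. c i n * r n (p i)) =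
      (\<Sum>f\<in>PiE {0..<d} (\<lambda>_. UNIV). (\<Prod>i=0..<d. c i (f i)) * (\<Prod>i=0..<d. r (f i) (p i)))" for p
    by (subst prod_sum_PiE) (auto simp: prod.distrib)
  then show ?thesis
    unfolding det by (simp add: sum_distrib_left mult.left_commute sum.swap[of _ "PiE _ _"])
qed

abbreviation minor :: "(real ^ 'n::finite) list \<Rightarrow> 'n list \<Rightarrow> real" where
  "minor ws bs \<equiv> Determinant.det (Matrix.mat (length ws) (length ws) (\<lambda>(i, j). ws ! i $ (bs ! j)))"

abbreviation axes :: "'n::finite list \<Rightarrow> (real ^ 'n) list" where
  "axes es \<equiv> map (\<lambda>s. axis s 1) es"

lemma minor_mult:
  assumes S: "card S = length es" and es: "set es \<subseteq> S" and len: "length ws = length es"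
  shows "minor (axes es) (basis_list S) * minor ws (basis_list S)
    = Determinant.det (Matrix.mat (length es) (length es) (\<lambda>(i, j). ws ! j $ (es ! i)))"
proof -
  let ?d = "length es" and ?b = "basis_list S"
  let ?P = "Matrix.mat ?d ?d (\<lambda>(i, j). axes es ! i $ (?b ! j))"
  let ?M = "Matrix.mat ?d ?d (\<lambda>(i, j). ws ! i $ (?b ! j))"
  let ?N = "Matrix.mat ?d ?d (\<lambda>(i, j). ws ! j $ (es ! i))"
  have "?N = ?P * transpose_mat ?M"
  proof (rule eq_matI)
    fix i l assume "i < dim_row (?P * transpose_mat ?M)" "l < dim_col (?P * transpose_mat ?M)"
    then have il: "i < ?d" "l < ?d" by auto
    have "es ! i \<in> set ?b" using il es basis_list[of S] by auto
    then obtain q where q: "q < ?d" "?b ! q = es ! i"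
      by (metis in_set_conv_nth length_basis_list S)
    have eq: "?b ! j = es ! i \<longleftrightarrow> j = q" if "j < ?d" for j
      using q that basis_list[of S] S nth_eq_iff_index_eq by metis
    have "(?P * transpose_mat ?M) $$ (i, l) = (\<Sum>j = 0..<?d. axis (es ! i) 1 $ (?b ! j) * ws ! l $ (?b ! j))"
      using il by (simp add: scalar_prod_def)
    also have "\<dots> = (\<Sum>j = 0..<?d. if j = q then ws ! l $ (es ! i) else 0)"
    proof (rule sum.cong)
      fix j assume "j \<in> {0..<?d}"
      then have "j < ?d" by simp
      from eq[OF this] q(2)
      show "axis (es ! i) 1 $ (?b ! j) * ws ! l $ (?b ! j) = (if j = q then ws ! l $ (es ! i) else 0)"
        by (cases "j = q") (auto simp: axis_def)
    qed simp
    also have "\<dots> = ws ! l $ (es ! i)" using q by simp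
    finally show "?N $$ (i, l) = (?P * transpose_mat ?M) $$ (i, l)" using il by simp
  qed auto
  then have "Determinant.det ?N = Determinant.det ?P * Determinant.det (transpose_mat ?M)"
    by (simp add: Determinant.det_mult[of _ ?d])
  then show ?thesis
    using Determinant.det_transpose[of ?M ?d] len by simp
qed

lemma minor_axes_zero:
  assumes "card S = length es" "\<not> set es \<subseteq> S"
  shows "minor (axes es) (basis_list S) = 0"
proof -
  obtain i where i: "i < length es" "es ! i \<notin> S"
    using assms by (metis in_set_conv_nth subsetI)
  let ?P = "Matrix.mat (length es) (length es) (\<lambda>(i, j). axes es ! i $ (basis_list S ! j))"
  have ne: "basis_list S ! j \<noteq> es ! i" if "j < length es" for j
    using that i assms basis_list[of S] nth_mem by metis
  have "mat\<^sub>r (length es) (length es) (\<lambda>j. if j = i then 0\<^sub>v (length es) else row ?P j) = ?P"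
    using i ne by (intro eq_matI) (auto simp: axis_def)
  then show ?thesis
    using Determinant.det_row_0[of i "length es" "row ?P"] i by auto
qed

lemma minor_axes_sum:
  assumes len: "length ws = length es"
  shows "(\<Sum>S | card S = length es. minor (axes es) (basis_list S) * minor ws (basis_list S))
    = Determinant.det (Matrix.mat (length es) (length es) (\<lambda>(i, j). ws ! j $ (es ! i)))"
    (is "_ = Determinant.det ?N")
proof (cases "distinct es")
  case True
  have "minor (axes es) (basis_list S) = 0" if "card S = length es" "S \<noteq> set es" for S
  proof (rule minor_axes_zero)
    show "\<not> set es \<subseteq> S"
      using that True by (metis card_subset_eq distinct_card finite)
  qed (fact that)
  then have "(\<Sum>S | card S = length es. minor (axes es) (basis_list S) * minor ws (basis_list S))
      = (\<Sum>S\<in>{set es}. minor (axes es) (basis_list S) * minor ws (basis_list S))"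
    using True by (intro sum.mono_neutral_right) (auto simp: distinct_card)
  then show ?thesis
    using minor_mult[of "set es" es ws] len True by (simp add: distinct_card)
next
  case False
  then obtain i j where ij: "i < length es" "j < length es" "i \<noteq> j" "es ! i = es ! j"
    by (auto simp: distinct_conv_nth)
  have 0: "Determinant.det (Matrix.mat (length es) (length es) (\<lambda>(i, j). g (es ! i) j)) = 0"
    for g :: "'a \<Rightarrow> nat \<Rightarrow> real"
    using ij by (intro Determinant.det_identical_rows[of _ "length es" i j]) auto
  have "Matrix.mat (length es) (length es) (\<lambda>(i, j). axes es ! i $ (basis_list S ! j)) =
      Matrix.mat (length es) (length es) (\<lambda>(i, j). axis (es ! i) 1 $ (basis_list S ! j))" for S
    by (intro eq_matI) auto
  then have "minor (axes es) (basis_list S) = 0" for S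
    using 0[of "\<lambda>e j. axis e 1 $ (basis_list S ! j)"] by simp
  moreover have "Determinant.det ?N = 0"
    using 0[of "\<lambda>e j. ws ! j $ e"] by simp
  ultimately show ?thesis by simp
qed

theorem wedge_inner:
  assumes len: "length us = d" "length ws = d"
  shows "wedge us \<bullet> wedge ws = Determinant.det (Matrix.mat d d (\<lambda>(i, j). (us ! i) \<bullet> (ws ! j)))"
proof -
  let ?F = "PiE {0..<d} (\<lambda>_. UNIV :: 'a set)"
  let ?c = "\<lambda>f. \<Prod>i=0..<d. us ! i $ (f i)"
  have us: "minor us bs = (\<Sum>f\<in>?F. ?c f * minor (axes (map f [0..<d])) bs)" for bs
  proof -
    have *: "(\<Sum>n\<in>UNIV. x $ n * axis n 1 $ b) = x $ b" for x :: "real ^ 'a" and b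
      by (simp add: axis_def if_distrib cong: if_cong)
    have "minor us bs = Determinant.det (Matrix.mat d d (\<lambda>(i, j). \<Sum>n\<in>UNIV. us ! i $ n * axis n 1 $ (bs ! j)))"
      using len * by simp
    also have "\<dots> = (\<Sum>f\<in>?F. ?c f * Determinant.det (Matrix.mat d d (\<lambda>(i, j). axis (f i) 1 $ (bs ! j))))"
      by (rule det_rows_expand)
    also have "\<dots> = (\<Sum>f\<in>?F. ?c f * minor (axes (map f [0..<d])) bs)"
      by (intro sum.cong arg_cong2[of _ _ _ _ "(*)"] arg_cong[of _ _ Determinant.det] eq_matI) auto
    finally show ?thesis .
  qed
  have "wedge us \<bullet> wedge ws = (\<Sum>S | card S = d. minor us (basis_list S) * minor ws (basis_list S))"
    using len by (auto simp: inner_vec_def wedge_def split: if_splits intro!: sum.mono_neutral_cong_right)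
  also have "\<dots> = (\<Sum>f\<in>?F. ?c f * (\<Sum>S | card S = d.
      minor (axes (map f [0..<d])) (basis_list S) * minor ws (basis_list S)))"
    unfolding us sum_distrib_right sum_distrib_left by (subst sum.swap) (simp add: mult.assoc)
  also have "\<dots> = (\<Sum>f\<in>?F. ?c f * Determinant.det (Matrix.mat d d (\<lambda>(i, j). ws ! j $ (f i))))"
  proof (intro sum.cong arg_cong2[of _ _ _ _ "(*)"] refl)
    fix f
    show "(\<Sum>S | card S = d. minor (axes (map f [0..<d])) (basis_list S) * minor ws (basis_list S))
        = Determinant.det (Matrix.mat d d (\<lambda>(i, j). ws ! j $ (f i)))"
      using minor_axes_sum[of ws "map f [0..<d]"] len
      by (auto intro!: arg_cong[of _ _ Determinant.det] eq_matI)
  qed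
  also have "\<dots> = Determinant.det (Matrix.mat d d (\<lambda>(i, j). \<Sum>n\<in>UNIV. us ! i $ n * ws ! j $ n))"
    by (rule det_rows_expand[symmetric])
  finally show ?thesis by (simp add: inner_vec_def)
qed

lemma wedge_basis_list: "wedge (map (\<lambda>s. axis s 1) (basis_list S)) = axis S 1"
proof -
  have "wedge (axes (basis_list S)) $ T = axis S 1 $ T" for T
  proof (cases "T = S")
    case True
    have "Matrix.mat (card S) (card S) (\<lambda>(i, j). axes (basis_list S) ! i $ (basis_list S ! j)) = 1\<^sub>m (card S)"
      using basis_list[of S] by (intro eq_matI) (auto simp: axis_def nth_eq_iff_index_eq)
    then show ?thesis using True by (simp add: wedge_def length_basis_list axis_def)
  next
    case False
    show ?thesis
    proof (cases "card T = card S")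
      case True
      then have "\<not> S \<subseteq> T" using False by (metis card_subset_eq finite)
      then show ?thesis
        using minor_axes_zero[of T "basis_list S"] basis_list[of S] False True
        by (simp add: wedge_def axis_def)
    qed (use False in \<open>simp add: wedge_def length_basis_list axis_def\<close>)
  qed
  then show ?thesis by (simp add: Finite_Cartesian_Product.vec_eq_iff)
qed

theorem span_wedge: "span {wedge ws | ws :: (real ^ 'n::finite) list. length ws = d} = ext_power d"
proof
  show "span {wedge ws | ws :: (real ^ 'n) list. length ws = d} \<subseteq> ext_power d"
    using wedge_in_ext_power by (intro span_minimal subspace_ext_power) auto
  show "ext_power d \<subseteq> span {wedge ws | ws :: (real ^ 'n) list. length ws = d}"
  proof
    fix x :: "real ^ ('n set)" assume x: "x \<in> ext_power d"
    have "(x $ S) *\<^sub>R axis S 1 \<in> span {wedge ws | ws :: (real ^ 'n) list. length ws = d}" for S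
    proof (cases "card S = d")
      case True
      have "axis S 1 \<in> {wedge ws | ws :: (real ^ 'n) list. length ws = d}"
        unfolding mem_Collect_eq
        by (rule exI[of _ "axes (basis_list S)"]) (simp add: wedge_basis_list length_basis_list True)
      then show ?thesis by (intro span_mul span_base)
    next
      case False
      then have "x $ S = 0" using x by (auto simp: ext_power_def)
      then show ?thesis by (simp add: span_zero)
    qed
    then have "(\<Sum>S\<in>UNIV. (x $ S) *\<^sub>R axis S 1) \<in> span {wedge ws | ws :: (real ^ 'n) list. length ws = d}"
      by (intro span_sum)
    then show "x \<in> span {wedge ws | ws :: (real ^ 'n) list. length ws = d}"
      using basis_expansion[of x] by (simp add: scalar_mult_eq_scaleR)
  qed
qed

lemma linear_ext_map: "linear (ext_map A)"
  by (rule linearI) (simp_all add: ext_map_def scaleR_left_distrib sum.distrib scaleR_sum_right)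

theorem ext_map_wedge: "ext_map A (wedge ws) = wedge (map (\<lambda>w. A *v w) ws)"
proof -
  let ?d = "length ws"
  have "ext_map A (wedge ws) $ T = wedge (map (\<lambda>w. A *v w) ws) $ T" for T
  proof (cases "card T = ?d")
    case False
    then show ?thesis
      by (auto simp: ext_map_def wedge_def length_basis_list intro!: sum.neutral)
  next
    case True
    let ?us = "map (\<lambda>b. A $ b) (basis_list T)"
    have A: "wedge (map (\<lambda>s. A *v axis s 1) (basis_list S)) $ T = wedge ?us $ S" if S: "card S = ?d" for S
    proof -
      let ?M = "Matrix.mat ?d ?d (\<lambda>(i, j). ?us ! i $ (basis_list S ! j))"
      have "Matrix.mat ?d ?d (\<lambda>(i, j). map (\<lambda>s. A *v axis s 1) (basis_list S) ! i $ (basis_list T ! j))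
          = transpose_mat ?M"
        using S True by (intro eq_matI)
          (auto simp: length_basis_list matrix_vector_mult_basis column_def)
      then show ?thesis
        using S True Determinant.det_transpose[of ?M ?d] by (simp add: wedge_def length_basis_list)
    qed
    have "ext_map A (wedge ws) $ T = (\<Sum>S\<in>UNIV. wedge ws $ S * wedge ?us $ S)"
      unfolding ext_map_def
      using A by (auto simp del: length_map simp: wedge_def[of ws] intro!: sum.cong)
    also have "\<dots> = wedge ws \<bullet> wedge ?us" by (simp add: inner_vec_def)
    also have "\<dots> = Determinant.det (Matrix.mat ?d ?d (\<lambda>(i, j). ws ! i \<bullet> ?us ! j))"
      using True by (intro wedge_inner) (auto simp: length_basis_list)
    also have "Matrix.mat ?d ?d (\<lambda>(i, j). ws ! i \<bullet> ?us ! j) =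
        Matrix.mat ?d ?d (\<lambda>(i, j). map (\<lambda>w. A *v w) ws ! i $ (basis_list T ! j))"
      using True by (intro eq_matI)
        (auto simp: length_basis_list matrix_vector_mul_component inner_commute)
    finally show ?thesis using True by (simp add: wedge_def)
  qed
  then show ?thesis by (simp add: Finite_Cartesian_Product.vec_eq_iff)
qed


section \<open>The tensor product and the tensor action\<close>

definition tensor :: "real ^ 'k \<Rightarrow> real ^ 'm \<Rightarrow> real ^ ('k::finite \<times> 'm::finite)" (infixr "\<otimes>\<^sub>v" 75) where
  "x \<otimes>\<^sub>v y = (\<chi> q. x $ fst q * y $ snd q)"

definition kron :: "real ^ 'k ^ 'k \<Rightarrow> real ^ 'm ^ 'm \<Rightarrow> real ^ ('k::finite \<times> 'm::finite) ^ ('k \<times> 'm)" where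
  "kron g h = (\<chi> q r. g $ fst q $ fst r * h $ snd q $ snd r)"

lemma inner_tensor: "(x \<otimes>\<^sub>v y) \<bullet> (x' \<otimes>\<^sub>v y') = (x \<bullet> x') * (y \<bullet> y')"
  by (simp add: tensor_def inner_vec_def UNIV_Times_UNIV[symmetric] sum.cartesian_product'
      sum_product algebra_simps del: UNIV_Times_UNIV)

lemma kron_tensor: "kron g h *v (x \<otimes>\<^sub>v y) = (g *v x) \<otimes>\<^sub>v (h *v y)"
  by (auto simp: kron_def tensor_def matrix_vector_mult_def Finite_Cartesian_Product.vec_eq_iff
      UNIV_Times_UNIV[symmetric] sum.cartesian_product' sum_product algebra_simps
      simp del: UNIV_Times_UNIV)


section \<open>Young diagrams and Schubert spans\<close>

text \<open>
  The index types \<open>'k\<close> and \<open>'m\<close> stand for the ordered sets \<open>[k]\<close> and \<open>[m]\<close>; the element \<open>j\<close>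
  of \<open>'m\<close> is the number \<open>card {..j}\<close> of \<open>[m]\<close>. A partition with at most \<open>k\<close> parts is a
  nonincreasing function on \<open>'k\<close>, padded by zeros.
\<close>

definition diagram :: "('k \<Rightarrow> nat) \<Rightarrow> ('k::{finite,linorder} \<times> 'm::{finite,linorder}) set" where
  "diagram p = {(i, j). card {..j} \<le> p i}"

definition young_diagrams :: "nat \<Rightarrow> ('k::{finite,linorder} \<times> 'm::{finite,linorder}) set set" where
  "young_diagrams d =
     {diagram p | p. antimono p \<and> (\<forall>i. p i \<le> CARD('m)) \<and> (\<Sum>i\<in>UNIV. p i) = d}"

definition schubert_vector :: "('k::finite \<times> 'm::finite) set \<Rightarrow> real ^ (('k \<times> 'm) set)" where
  "schubert_vector L = wedge (map (\<lambda>(i, j). axis i 1 \<otimes>\<^sub>v axis j 1) (basis_list L))"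

definition schubert_span :: "('k::finite \<times> 'm::finite) set \<Rightarrow> (real ^ (('k \<times> 'm) set)) set" where
  "schubert_span L = span {ext_map (kron g h) (schubert_vector L) | g h.
     orthogonal_matrix g \<and> orthogonal_matrix h}"

definition orthogonal_decomposition :: "'v::real_inner set \<Rightarrow> 'i set \<Rightarrow> ('i \<Rightarrow> 'v set) \<Rightarrow> bool" where
  "orthogonal_decomposition W I V \<longleftrightarrow>
     (\<forall>i\<in>I. subspace (V i) \<and> V i \<subseteq> W) \<and>
     (\<forall>i\<in>I. \<forall>j\<in>I. i \<noteq> j \<longrightarrow> (\<forall>x\<in>V i. \<forall>y\<in>V j. x \<bullet> y = 0)) \<and>
     (\<forall>w\<in>W. \<exists>!x. x \<in> PiE I V \<and> w = (\<Sum>i\<in>I. x i))"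

end

theory Submission
  imports Defs
begin

text \<open>
  Orthogonality. The inner product of \<open>(g, h) \<cdot> v\<^sub>L\<close> and \<open>(g', h') \<cdot> v\<^sub>M\<close> is a determinant with
  entries \<open>G\<^sub>a\<^sub>i H\<^sub>b\<^sub>j\<close>, where \<open>(a, b)\<close> runs over \<open>M\<close> and \<open>(i, j)\<close> over \<open>L\<close>. If some initial
  segment \<open>D\<close> of columns leaves fewer boxes of \<open>M\<close> than of \<open>L\<close> outside \<open>D\<close>, counting equations
  shows that this matrix is singular for arbitrary \<open>G\<close> and \<open>H\<close>. Two diagrams for which
  all these numbers agree are equal.

  Spanning. Let \<open>E\<^sub>i\<^sub>j\<close> and \<open>F\<^sub>a\<^sub>b\<close> be the derivations of the exterior algebra moving a box from row \<open>j\<close>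
  to row \<open>i\<close>, respectively from column \<open>b\<close> to column \<open>a\<close>. The Casimir operators give
  \<open>(\<Sum>i<j. E\<^sub>j\<^sub>i E\<^sub>i\<^sub>j + \<Sum>a<b. F\<^sub>b\<^sub>a F\<^sub>a\<^sub>b) e\<^sub>S = N(S) e\<^sub>S\<close>, where \<open>N(S)\<close> counts the pairs of a box of \<open>S\<close>
  and a box missing from \<open>S\<close> above it in its column or left of it in its row. So
  \<open>N(S) > 0\<close> unless \<open>S\<close> is a diagram. A subspace invariant under \<open>O(k) \<times> O(m)\<close> is
  invariant under \<open>E\<^sub>j\<^sub>i - E\<^sub>i\<^sub>j\<close> and \<open>F\<^sub>b\<^sub>a - F\<^sub>a\<^sub>b\<close>. As \<open>E\<^sub>i\<^sub>j\<close> and \<open>F\<^sub>a\<^sub>b\<close> move boxes up or left,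
  induction shows that such a subspace contains \<open>e\<^sub>S\<close> for every \<open>S\<close> with \<open>d\<close> boxes if it
  does so for the diagrams.
\<close>

section \<open>Multilinearity and derivatives of wedge products\<close>

lemma wedge_nth:
  "wedge ws $ S = (if card S = length ws
     then \<Sum>\<pi> | \<pi> permutes {0..<length ws}. signof \<pi> *
       (\<Prod>i=0..<length ws. ws ! i $ (basis_list S ! \<pi> i)) else 0)"
proof (cases "card S = length ws")
  case True
  then show ?thesis
    by (simp add: wedge_def, subst Determinant.det_def'[of _ "length ws"])
       (auto simp: permutes_in_image intro!: sum.cong prod.cong)
qed (simp add: wedge_def)

lemma prod_list_update:
  fixes h :: "nat \<Rightarrow> 'a \<Rightarrow> 'b::comm_monoid_mult"
  assumes "p < length ws"
  shows "(\<Prod>i=0..<length ws. h i (ws[p := x] ! i)) =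
    h p x * (\<Prod>i\<in>{0..<length ws} - {p}. h i (ws ! i))"
proof -
  have "(\<Prod>i=0..<length ws. h i (ws[p := x] ! i)) =
      h p (ws[p := x] ! p) * (\<Prod>i\<in>{0..<length ws} - {p}. h i (ws[p := x] ! i))"
    using assms by (intro prod.remove) auto
  also have "(\<Prod>i\<in>{0..<length ws} - {p}. h i (ws[p := x] ! i)) =
      (\<Prod>i\<in>{0..<length ws} - {p}. h i (ws ! i))"
    by (intro prod.cong) auto
  finally show ?thesis using assms by simp
qed

lemma wedge_update_nth:
  assumes "p < length ws"
  shows "wedge (ws[p := x]) $ S = (if card S = length ws
     then \<Sum>\<pi> | \<pi> permutes {0..<length ws}. signof \<pi> *
       (x $ (basis_list S ! \<pi> p) *
        (\<Prod>i\<in>{0..<length ws} - {p}. ws ! i $ (basis_list S ! \<pi> i))) else 0)"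
  using prod_list_update[OF assms, of "\<lambda>i v. v $ (basis_list S ! \<pi> i)" x for \<pi>]
  by (simp add: wedge_nth)

lemma wedge_update_scaleR:
  assumes "p < length ws"
  shows "wedge (ws[p := c *\<^sub>R x]) = c *\<^sub>R wedge (ws[p := x])"
  using assms
  by (simp add: Finite_Cartesian_Product.vec_eq_iff wedge_update_nth sum_distrib_left mult_ac)

lemma wedge_swap:
  assumes p: "p < length ws" and q: "q < length ws" and "p \<noteq> q"
  shows "wedge (ws[p := ws ! q, q := ws ! p]) = - wedge ws"
proof -
  let ?\<tau> = "Transposition.transpose p q" and ?d = "length ws"
  have \<tau>: "?\<tau> permutes {0..<?d}" using p q by (simp add: permutes_swap_id)
  have nth: "ws[p := ws ! q, q := ws ! p] ! i = ws ! ?\<tau> i" if "i < ?d" for i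
    using that p q by (auto simp: nth_list_update Transposition.transpose_def)
  have "minor (ws[p := ws ! q, q := ws ! p]) bs = - minor ws bs" for bs
  proof -
    let ?M = "Matrix.mat ?d ?d (\<lambda>(i, j). ws ! i $ (bs ! j))"
    have "Matrix.mat ?d ?d (\<lambda>(i, j). ws[p := ws ! q, q := ws ! p] ! i $ (bs ! j)) =
        Matrix.mat ?d ?d (\<lambda>(i, j). ?M $$ (?\<tau> i, j))"
      using \<tau> permutes_in_image[OF \<tau>] nth by (intro eq_matI) auto
    then show ?thesis
      using Determinant.det_permute_rows[of ?M ?d ?\<tau>] \<tau> \<open>p \<noteq> q\<close>
      by (simp add: sign_swap_id)
  qed
  then show ?thesis by (simp add: Finite_Cartesian_Product.vec_eq_iff wedge_def)
qed

lemma wedge_axes_repeated: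
  assumes "\<not> distinct bs"
  shows "wedge (axes bs) = 0"
proof -
  obtain p q where pq: "p < length bs" "q < length bs" "p \<noteq> q" "bs ! p = bs ! q"
    using assms by (auto simp: distinct_conv_nth)
  then have "(axes bs)[p := axes bs ! q, q := axes bs ! p] = axes bs"
    by (auto simp: list_eq_iff_nth_eq nth_list_update)
  then have "wedge (axes bs) = - wedge (axes bs)"
    using wedge_swap[of p "axes bs" q] pq by simp
  then show ?thesis by (simp add: Finite_Cartesian_Product.vec_eq_iff)
qed

lemma axis_nth_if: "axis b x $ n = (if n = b then x else 0)"
  by (simp add: axis_def)

text \<open>The coefficient is the sign of the permutation relating \<open>bs\<close> to
  \<open>basis_list (set bs)\<close>. At any other set of the same size the minor has a zero
  row.\<close>

lemma wedge_axes_distinct: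
  assumes "distinct bs"
  shows "\<exists>c. wedge (axes bs) = c *\<^sub>R axis (set bs) 1"
proof
  have *: "wedge (axes bs) $ T = (wedge (axes bs) $ set bs) * axis (set bs) 1 $ T" for T
  proof (cases "card T = length bs \<and> T \<noteq> set bs")
    case True
    then have "\<not> set bs \<subseteq> T"
      using assms by (metis card_subset_eq distinct_card finite)
    then show ?thesis using True minor_axes_zero[of T bs] by (simp add: wedge_def axis_def)
  next
    case False
    then show ?thesis
    proof (cases "T = set bs")
      case True
      then show ?thesis by (simp only: axis_nth_if if_True simp_thms mult_1_right)
    next
      case neq: False
      then have "wedge (axes bs) $ T = 0" using False by (simp add: wedge_def)
      then show ?thesis using neq by (simp add: axis_nth_if)
    qed
  qed
  show "wedge (axes bs) = (wedge (axes bs) $ set bs) *\<^sub>R axis (set bs) 1"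
    unfolding Finite_Cartesian_Product.vec_eq_iff vector_scaleR_component real_scaleR_def
    by (intro allI *)
qed

text \<open>Product rule: each coordinate is a signed sum of products with one entry from every
  factor, so differentiation replaces one factor at a time.\<close>

lemma DERIV_wedge:
  fixes f :: "nat \<Rightarrow> real \<Rightarrow> real ^ 'n::finite"
  assumes f: "\<And>p n. p < d \<Longrightarrow> ((\<lambda>t. f p t $ n) has_real_derivative D p $ n) (at a)"
  shows "((\<lambda>t. wedge (map (\<lambda>p. f p t) [0..<d]) $ S) has_real_derivative
    (\<Sum>p<d. wedge ((map (\<lambda>p. f p a) [0..<d])[p := D p]) $ S)) (at a)"
proof (cases "card S = d")
  case True
  have P: "((\<lambda>t. \<Prod>i=0..<d. f i t $ (basis_list S ! \<pi> i)) has_real_derivative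
      (\<Sum>p=0..<d. D p $ (basis_list S ! \<pi> p) *
        (\<Prod>i\<in>{0..<d} - {p}. f i a $ (basis_list S ! \<pi> i)))) (at a)" for \<pi>
    unfolding has_field_derivative_def
    by (rule has_derivative_eq_rhs, rule has_derivative_prod,
        rule f[unfolded has_field_derivative_def])
       (auto simp: fun_eq_iff sum_distrib_right sum_distrib_left mult_ac)
  have eq: "wedge (map (\<lambda>p. f p t) [0..<d]) $ S = (\<Sum>\<pi> | \<pi> permutes {0..<d}. signof \<pi> *
       (\<Prod>i=0..<d. f i t $ (basis_list S ! \<pi> i)))" for t
    using True by (simp add: wedge_nth)
  have D: "(\<Sum>p<d. wedge ((map (\<lambda>p. f p a) [0..<d])[p := D p]) $ S) =
      (\<Sum>\<pi> | \<pi> permutes {0..<d}. signof \<pi> *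
       (\<Sum>p=0..<d. D p $ (basis_list S ! \<pi> p) *
        (\<Prod>i\<in>{0..<d} - {p}. f i a $ (basis_list S ! \<pi> i))))"
    using True
    by (simp add: wedge_update_nth sum_distrib_left lessThan_atLeast0) (rule sum.swap)
  show ?thesis unfolding eq D
    by (intro DERIV_sum DERIV_cmult P)
next
  case False
  then show ?thesis by (simp add: wedge_nth)
qed

text \<open>A curve in a subspace has its velocity there: whatever is orthogonal to the curve is
  orthogonal to the velocity, and in finite dimension \<open>W\<close> is its own double
  complement.\<close>

lemma sum_wedge_tangent_mem:
  fixes f :: "nat \<Rightarrow> real \<Rightarrow> real ^ 'n::finite"
  assumes W: "subspace W" and mem: "\<And>t. wedge (map (\<lambda>p. f p t) [0..<d]) \<in> W"
    and f: "\<And>p n. p < d \<Longrightarrow> ((\<lambda>t. f p t $ n) has_real_derivative D p $ n) (at a)"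
  shows "(\<Sum>p<d. wedge ((map (\<lambda>p. f p a) [0..<d])[p := D p])) \<in> W" (is "?D \<in> W")
proof -
  have "y \<bullet> ?D = 0" if y: "y \<in> W\<^sup>\<bottom>" for y
  proof -
    let ?w = "\<lambda>t. wedge (map (\<lambda>p. f p t) [0..<d])"
    have 0: "y \<bullet> ?w t = 0" for t
      using y mem[of t] by (auto simp: orthogonal_comp_def real_inner_class.orthogonal_def inner_commute)
    have "((\<lambda>t. y \<bullet> ?w t) has_real_derivative y \<bullet> ?D) (at a)"
      unfolding inner_vec_def inner_real_def sum_component
      by (intro DERIV_sum DERIV_cmult DERIV_wedge f)
    then show ?thesis unfolding 0 using DERIV_unique DERIV_const by blast
  qed
  then have "?D \<in> W\<^sup>\<bottom>\<^sup>\<bottom>" by (auto simp: orthogonal_comp_def real_inner_class.orthogonal_def)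
  then show ?thesis using orthogonal_comp_self[OF W] by simp
qed

text \<open>
  The derivative at 0 of \<open>A\<close> is \<open>E\<^sub>i\<^sub>j - E\<^sub>j\<^sub>i\<close>. If \<open>W\<close> contains every term of \<open>E\<^sub>i\<^sub>j w\<close>, it therefore
  contains \<open>E\<^sub>j\<^sub>i w\<close>.
\<close>
lemma sum_exchange_mem:
  fixes bs :: "'n::finite list" and pr :: "'n \<Rightarrow> 'l" and upd :: "'l \<Rightarrow> 'n \<Rightarrow> 'n"
  assumes W: "subspace W" and "i \<noteq> j"
    and inv: "\<And>t x. x \<in> W \<Longrightarrow> ext_map (A t) x \<in> W"
    and A0: "\<And>b. A 0 *v axis b 1 = axis b 1"
    and A: "\<And>b n. ((\<lambda>t. (A t *v axis b 1) $ n) has_real_derivative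
      (if pr b = j then axis (upd i b) 1 $ n
       else if pr b = i then - (axis (upd j b) 1 $ n) else 0)) (at 0)"
    and bs: "wedge (axes bs) \<in> W"
    and up: "\<And>q. q < length bs \<Longrightarrow> pr (bs ! q) = j \<Longrightarrow> wedge (axes (bs[q := upd i (bs ! q)])) \<in> W"
  shows "(\<Sum>q | q < length bs \<and> pr (bs ! q) = i. wedge (axes (bs[q := upd j (bs ! q)]))) \<in> W"
proof -
  \<comment> \<open>\<open>c\<close> and \<open>u\<close> merge the cases of the derivative into one
    scaled basis vector per factor, so that the scalar can be pulled out of the wedge.\<close>
  define c where "c b = (if pr b = j then 1 else if pr b = i then -1 else 0 :: real)" for b
  define u where "u b = (if pr b = j then upd i b else upd j b)" for b
  let ?d = "length bs"
  let ?f = "\<lambda>p t. A t *v axis (bs ! p) 1"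
  have eq: "map (\<lambda>p. ?f p 0) [0..<?d] = axes bs"
    by (rule nth_equalityI) (simp_all add: A0)
  have "(\<Sum>p<?d. wedge ((map (\<lambda>p. ?f p 0) [0..<?d])[p := c (bs ! p) *\<^sub>R axis (u (bs ! p)) 1])) \<in> W"
  proof (rule sum_wedge_tangent_mem[OF W, where f = ?f and a = 0])
    fix t
    have "map (\<lambda>p. ?f p t) [0..<?d] = map (\<lambda>v. A t *v v) (axes bs)"
      by (rule nth_equalityI) simp_all
    then show "wedge (map (\<lambda>p. ?f p t) [0..<?d]) \<in> W"
      using inv[OF bs] by (metis ext_map_wedge)
  next
    fix p n
    show "((\<lambda>t. ?f p t $ n) has_real_derivative (c (bs ! p) *\<^sub>R axis (u (bs ! p)) 1) $ n) (at 0)"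
      by (rule DERIV_cong[OF A]) (auto simp: c_def u_def)
  qed
  then have sum: "(\<Sum>p<?d. c (bs ! p) *\<^sub>R wedge (axes (bs[p := u (bs ! p)]))) \<in> W"
    unfolding eq by (simp add: wedge_update_scaleR map_update)
  have up': "(\<Sum>p | p < ?d \<and> pr (bs ! p) = j. wedge (axes (bs[p := upd i (bs ! p)]))) \<in> W"
    using up by (intro subspace_sum[OF W]) auto
  have "(\<Sum>p<?d. c (bs ! p) *\<^sub>R wedge (axes (bs[p := u (bs ! p)]))) =
      (\<Sum>p<?d. (if pr (bs ! p) = j then wedge (axes (bs[p := upd i (bs ! p)])) else 0)
        - (if pr (bs ! p) = i then wedge (axes (bs[p := upd j (bs ! p)])) else 0))"
    using \<open>i \<noteq> j\<close> by (intro sum.cong) (auto simp: c_def u_def)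
  also have "\<dots> = (\<Sum>p | p < ?d \<and> pr (bs ! p) = j. wedge (axes (bs[p := upd i (bs ! p)])))
      - (\<Sum>p | p < ?d \<and> pr (bs ! p) = i. wedge (axes (bs[p := upd j (bs ! p)])))"
    by (simp add: sum_subtractf sum.If_cases lessThan_def Int_def)
  finally show ?thesis
    using subspace_diff[OF W up' sum] by simp
qed

section \<open>Plane rotations and the exchange of rows or columns\<close>

definition rotation :: "'l \<Rightarrow> 'l \<Rightarrow> real \<Rightarrow> real ^ 'l ^ 'l::finite" where
  "rotation i j t = (\<chi> a b.
     if a = i then (if b = i then cos t else if b = j then sin t else 0)
     else if a = j then (if b = i then - sin t else if b = j then cos t else 0)
     else if a = b then 1 else 0)"

lemma orthogonal_rotation:
  assumes "i \<noteq> j"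
  shows "orthogonal_matrix (rotation i j t)"
proof -
  let ?R = "rotation i j t"
  have "(\<Sum>c\<in>UNIV. ?R $ c $ a * ?R $ c $ b) = (if a = b then 1 else 0)" for a b
  proof -
    \<comment> \<open>Only the rows \<open>i\<close> and \<open>j\<close> differ from those of the
      identity matrix, so they are split off.\<close>
    have "(\<Sum>c\<in>UNIV. ?R $ c $ a * ?R $ c $ b) =
        ?R $ i $ a * ?R $ i $ b + (?R $ j $ a * ?R $ j $ b + (\<Sum>c\<in>UNIV - {i} - {j}. ?R $ c $ a * ?R $ c $ b))"
      using assms by (subst sum.remove[of _ i], simp, simp, subst sum.remove[of _ j]) auto
    also have "(\<Sum>c\<in>UNIV - {i} - {j}. ?R $ c $ a * ?R $ c $ b) =
        (\<Sum>c\<in>UNIV - {i} - {j}. if c = a then (if a = b then 1 else 0) else 0)"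
      by (intro sum.cong) (auto simp: rotation_def)
    also have "\<dots> = (if a \<noteq> i \<and> a \<noteq> j \<and> a = b then 1 else 0)"
      by (subst sum.delta) auto
    finally show ?thesis
      using assms sin_cos_squared_add[of t]
      by (auto simp: rotation_def power2_eq_square algebra_simps)
  qed
  then show ?thesis
    unfolding orthogonal_matrix
    by (simp add: Finite_Cartesian_Product.vec_eq_iff matrix_matrix_mult_def
        Finite_Cartesian_Product.transpose_def Finite_Cartesian_Product.mat_def)
qed

lemma kron_axis_nth: "(kron g h *v axis b 1) $ n = g $ fst n $ fst b * h $ snd n $ snd b"
  by (simp add: matrix_vector_mult_basis column_def kron_def)

lemma rotation_0: "rotation i j 0 = Finite_Cartesian_Product.mat 1"
  by (auto simp: rotation_def Finite_Cartesian_Product.mat_def Finite_Cartesian_Product.vec_eq_iff)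

text \<open>The infinitesimal rotation moves index \<open>j\<close> to \<open>i\<close>, and
  \<open>i\<close> to \<open>j\<close> with a minus sign. This is the shape that
  \<open>sum_exchange_mem\<close> asks for.\<close>

lemma DERIV_rotation:
  assumes "i \<noteq> j"
  shows "((\<lambda>t. rotation i j t $ a $ b) has_real_derivative
    (if b = j then of_bool (a = i) else if b = i then - of_bool (a = j) else 0)) (at 0)"
  using assms DERIV_sin[of "0::real"] DERIV_cos[of "0::real"] DERIV_minus[OF DERIV_sin[of "0::real"]]
  by (simp add: rotation_def)

text \<open>Rotating the first tensor factor and fixing the second changes only the row indices of
  boxes, so \<open>sum_exchange_mem\<close> applies with \<open>fst\<close> as the index.\<close>

lemma sum_row_exchange_mem:
  fixes bs :: "('k::finite \<times> 'm::finite) list"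
  assumes W: "subspace W" and "i \<noteq> j"
    and inv: "\<And>g h x. orthogonal_matrix g \<Longrightarrow> orthogonal_matrix h \<Longrightarrow> x \<in> W
      \<Longrightarrow> ext_map (kron g h) x \<in> W"
    and bs: "wedge (axes bs) \<in> W"
    and up: "\<And>q. q < length bs \<Longrightarrow> fst (bs ! q) = j
      \<Longrightarrow> wedge (axes (bs[q := (i, snd (bs ! q))])) \<in> W"
  shows "(\<Sum>q | q < length bs \<and> fst (bs ! q) = i. wedge (axes (bs[q := (j, snd (bs ! q))]))) \<in> W"
proof (rule sum_exchange_mem[where pr = fst and upd = "\<lambda>r b. (r, snd b)"
      and A = "\<lambda>t. kron (rotation i j t) (Finite_Cartesian_Product.mat 1)", OF W \<open>i \<noteq> j\<close>])
  show "ext_map (kron (rotation i j t) (Finite_Cartesian_Product.mat 1)) x \<in> W" if "x \<in> W" for t x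
    using that by (intro inv orthogonal_rotation orthogonal_matrix_id \<open>i \<noteq> j\<close>)
  show "kron (rotation i j 0) (Finite_Cartesian_Product.mat 1) *v axis b 1 = axis b 1" for b
    by (cases b) (auto simp: kron_axis_nth Finite_Cartesian_Product.vec_eq_iff rotation_0
        Finite_Cartesian_Product.mat_def axis_nth_if)
  show "((\<lambda>t. (kron (rotation i j t) (Finite_Cartesian_Product.mat 1) *v axis b 1) $ n)
      has_real_derivative (if fst b = j then axis (i, snd b) 1 $ n
      else if fst b = i then - (axis (j, snd b) 1 $ n) else 0)) (at 0)" for b n
    unfolding kron_axis_nth
    by (rule DERIV_cong[OF DERIV_cmult_right[OF DERIV_rotation[OF \<open>i \<noteq> j\<close>]]])
       (cases b, cases n, auto simp: Finite_Cartesian_Product.mat_def axis_nth_if)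
qed (fact bs, rule up)

lemma sum_column_exchange_mem:
  fixes bs :: "('k::finite \<times> 'm::finite) list"
  assumes W: "subspace W" and "i \<noteq> j"
    and inv: "\<And>g h x. orthogonal_matrix g \<Longrightarrow> orthogonal_matrix h \<Longrightarrow> x \<in> W
      \<Longrightarrow> ext_map (kron g h) x \<in> W"
    and bs: "wedge (axes bs) \<in> W"
    and up: "\<And>q. q < length bs \<Longrightarrow> snd (bs ! q) = j
      \<Longrightarrow> wedge (axes (bs[q := (fst (bs ! q), i)])) \<in> W"
  shows "(\<Sum>q | q < length bs \<and> snd (bs ! q) = i. wedge (axes (bs[q := (fst (bs ! q), j)]))) \<in> W"
proof (rule sum_exchange_mem[where pr = snd and upd = "\<lambda>c b. (fst b, c)"
      and A = "\<lambda>t. kron (Finite_Cartesian_Product.mat 1) (rotation i j t)", OF W \<open>i \<noteq> j\<close>])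
  show "ext_map (kron (Finite_Cartesian_Product.mat 1) (rotation i j t)) x \<in> W" if "x \<in> W" for t x
    using that by (intro inv orthogonal_rotation orthogonal_matrix_id \<open>i \<noteq> j\<close>)
  show "kron (Finite_Cartesian_Product.mat 1) (rotation i j 0) *v axis b 1 = axis b 1" for b
    by (cases b) (auto simp: kron_axis_nth Finite_Cartesian_Product.vec_eq_iff rotation_0
        Finite_Cartesian_Product.mat_def axis_nth_if)
  show "((\<lambda>t. (kron (Finite_Cartesian_Product.mat 1) (rotation i j t) *v axis b 1) $ n)
      has_real_derivative (if snd b = j then axis (fst b, i) 1 $ n
      else if snd b = i then - (axis (fst b, j) 1 $ n) else 0)) (at 0)" for b n
    unfolding kron_axis_nth
    by (rule DERIV_cong[OF DERIV_cmult[OF DERIV_rotation[OF \<open>i \<noteq> j\<close>]]])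
       (cases b, cases n, auto simp: Finite_Cartesian_Product.mat_def axis_nth_if)
qed (fact bs, rule up)

text \<open>A double sum over a square sees only the symmetric part of its summand: adding the sum
  with both indices swapped doubles it.\<close>

lemma sum_sum_symmetrize:
  fixes f g :: "'i \<Rightarrow> 'i \<Rightarrow> 'v::real_vector"
  assumes "\<And>p q. p \<in> A \<Longrightarrow> q \<in> A \<Longrightarrow> f p q + f q p = g p q + g q p"
  shows "(\<Sum>p\<in>A. \<Sum>q\<in>A. f p q) = (\<Sum>p\<in>A. \<Sum>q\<in>A. g p q)"
proof -
  have double: "2 *\<^sub>R (\<Sum>p\<in>A. \<Sum>q\<in>A. h p q) = (\<Sum>p\<in>A. \<Sum>q\<in>A. h p q + h q p)"
    for h :: "'i \<Rightarrow> 'i \<Rightarrow> 'v"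
    using sum.swap[of h A A] by (simp add: sum.distrib scaleR_2)
  have "2 *\<^sub>R (\<Sum>p\<in>A. \<Sum>q\<in>A. f p q) = 2 *\<^sub>R (\<Sum>p\<in>A. \<Sum>q\<in>A. g p q)"
    unfolding double using assms by (intro sum.cong) auto
  then show ?thesis by simp
qed

section \<open>Raising and lowering boxes\<close>

text \<open>
  The left-hand side is the contribution of the \<open>p\<close>-th factor to \<open>\<Sum>i<j. E\<^sub>j\<^sub>i E\<^sub>i\<^sub>j w\<close>: \<open>E\<^sub>j\<^sub>i\<close> either moves
  this factor back or exchanges its row (column) with that of another factor \<open>q\<close>.
\<close>
lemma lowering_raising_mem:
  fixes bs :: "'n::finite list" and pr :: "'n \<Rightarrow> 'l::{finite,linorder}"
  assumes W: "subspace W" and p: "p < length bs"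
    and pr_upd: "\<And>i b. pr (upd i b) = i"
    and upd_upd: "\<And>i i' b. upd i' (upd i b) = upd i' b"
    and upd_pr: "\<And>b. upd (pr b) b = b"
    and exchange: "\<And>i j cs. i \<noteq> j \<Longrightarrow> wedge (axes cs) \<in> W
      \<Longrightarrow> (\<And>q. q < length cs \<Longrightarrow> pr (cs ! q) = j \<Longrightarrow> wedge (axes (cs[q := upd i (cs ! q)])) \<in> W)
      \<Longrightarrow> (\<Sum>q | q < length cs \<and> pr (cs ! q) = i. wedge (axes (cs[q := upd j (cs ! q)]))) \<in> W"
    and raised: "\<And>i. i < pr (bs ! p) \<Longrightarrow> wedge (axes (bs[p := upd i (bs ! p)])) \<in> W"
    and raised2: "\<And>i q. i < pr (bs ! p) \<Longrightarrow> q < length bs \<Longrightarrow> q \<noteq> p \<Longrightarrow> pr (bs ! q) = pr (bs ! p)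
      \<Longrightarrow> wedge (axes (bs[p := upd i (bs ! p), q := upd i (bs ! q)])) \<in> W"
  shows "real (card {..<pr (bs ! p)}) *\<^sub>R wedge (axes bs) +
    (\<Sum>q<length bs. of_bool (pr (bs ! q) < pr (bs ! p)) *\<^sub>R
      wedge (axes (bs[p := upd (pr (bs ! q)) (bs ! p), q := upd (pr (bs ! p)) (bs ! q)]))) \<in> W"
proof -
  let ?d = "length bs" and ?j = "pr (bs ! p)"
  define x where "x q = wedge (axes (bs[p := upd (pr (bs ! q)) (bs ! p), q := upd ?j (bs ! q)]))" for q
  have 1: "wedge (axes bs) + (\<Sum>q | q < ?d \<and> pr (bs ! q) = i. x q) \<in> W" if i: "i < ?j" for i
  proof -
    let ?cs = "bs[p := upd i (bs ! p)]"
    have "(\<Sum>q | q < length ?cs \<and> pr (?cs ! q) = i. wedge (axes (?cs[q := upd ?j (?cs ! q)]))) \<in> W"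
    proof (rule exchange)
      fix q assume q: "q < length ?cs" "pr (?cs ! q) = ?j"
      then have "q \<noteq> p" using i p pr_upd by auto
      then show "wedge (axes (?cs[q := upd i (?cs ! q)])) \<in> W"
        using raised2[OF i, of q] q by simp
    qed (use i raised in auto)
    moreover have "{q. q < length ?cs \<and> pr (?cs ! q) = i} = insert p {q. q < ?d \<and> pr (bs ! q) = i}"
      using p by (auto simp: nth_list_update pr_upd)
    moreover have "p \<notin> {q. q < ?d \<and> pr (bs ! q) = i}" using i by auto
    moreover have "wedge (axes (?cs[p := upd ?j (?cs ! p)])) = wedge (axes bs)"
      using p by (simp add: upd_upd upd_pr)
    moreover have "(\<Sum>q | q < ?d \<and> pr (bs ! q) = i. wedge (axes (?cs[q := upd ?j (?cs ! q)]))) =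
        (\<Sum>q | q < ?d \<and> pr (bs ! q) = i. x q)"
      using i p by (intro sum.cong) (auto simp: x_def nth_list_update)
    ultimately show ?thesis by simp
  qed
  have "(\<Sum>i<?j. wedge (axes bs) + (\<Sum>q | q < ?d \<and> pr (bs ! q) = i. x q)) \<in> W"
    using 1 by (intro subspace_sum[OF W]) simp
  also have "(\<Sum>i<?j. wedge (axes bs) + (\<Sum>q | q < ?d \<and> pr (bs ! q) = i. x q)) =
      real (card {..<?j}) *\<^sub>R wedge (axes bs) + (\<Sum>i<?j. \<Sum>q | q < ?d \<and> pr (bs ! q) = i. x q)"
    by (simp add: sum.distrib sum_constant_scaleR del: sum_constant)
  \<comment> \<open>Each \<open>q\<close> with index below \<open>?j\<close> occurs for exactly one
    \<open>i\<close>, namely its own index.\<close>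
  also have "(\<Sum>i<?j. \<Sum>q | q < ?d \<and> pr (bs ! q) = i. x q) =
      (\<Sum>i<?j. sum x {q \<in> {q. q < ?d \<and> pr (bs ! q) < ?j}. pr (bs ! q) = i})"
    by (intro sum.cong arg_cong[of _ _ "sum x"]) auto
  also have "\<dots> = (\<Sum>q | q < ?d \<and> pr (bs ! q) < ?j. x q)"
    by (intro sum.group) auto
  also have "\<dots> = (\<Sum>q<?d. of_bool (pr (bs ! q) < ?j) *\<^sub>R x q)"
    by (intro sum.mono_neutral_cong_left) auto
  finally show ?thesis unfolding x_def .
qed

section \<open>Order ideals, heights and the induction step for spanning\<close>

definition order_ideal :: "('k::linorder \<times> 'm::linorder) set \<Rightarrow> bool" where
  "order_ideal L \<longleftrightarrow> (\<forall>i j i' j'. (i, j) \<in> L \<longrightarrow> i' \<le> i \<longrightarrow> j' \<le> j \<longrightarrow> (i', j') \<in> L)"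

lemma order_idealD: "order_ideal L \<Longrightarrow> (i, j) \<in> L \<Longrightarrow> i' \<le> i \<Longrightarrow> j' \<le> j \<Longrightarrow> (i', j') \<in> L"
  by (auto simp: order_ideal_def)

text \<open>From a box of \<open>L\<close>, walk to a missing box above and to the left of it, first
  along the column and then along the row. If the corner is missing, the column shows the gap;
  otherwise the row does.\<close>

lemma not_order_idealE:
  assumes "\<not> order_ideal L"
  obtains i j i' where "(i, j) \<in> L" "i' < i" "(i', j) \<notin> L"
  | i j j' where "(i, j) \<in> L" "j' < j" "(i, j') \<notin> L"
  using assms unfolding order_ideal_def by (metis order_le_less)

text \<open>Total distance of the boxes from the top left corner. It serves as induction measure
  because moving a box up or left lowers it, even if boxes then coincide.\<close>

definition height :: "('k::{finite,linorder} \<times> 'm::{finite,linorder}) list \<Rightarrow> nat" where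
  "height bs = (\<Sum>b\<leftarrow>bs. card {..<fst b} + card {..<snd b})"

lemma card_lessThan_mono: "i < j \<Longrightarrow> card {..<i} < card {..<j}" for i j :: "'l::{finite,linorder}"
  by (intro psubset_card_mono) auto

lemma height_update_less:
  assumes "p < length bs"
    and "card {..<fst b} + card {..<snd b} < card {..<fst (bs ! p)} + card {..<snd (bs ! p)}"
  shows "height (bs[p := b]) < height bs"
proof -
  let ?h = "\<lambda>b. card {..<fst b} + card {..<snd b}"
  \<comment> \<open>The subtraction of natural numbers below is truncated, so the removed entry has
    to be bounded by the total.\<close>
  have "map ?h bs ! p \<le> sum_list (map ?h bs)"
    using assms by (intro elem_le_sum_list) simp
  moreover have "height (bs[p := b]) = sum_list (map ?h bs) + ?h b - map ?h bs ! p"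
    using assms by (simp add: height_def map_update sum_list_update)
  ultimately show ?thesis using assms by (simp add: height_def)
qed

lemma height_row_less:
  "p < length bs \<Longrightarrow> i < fst (bs ! p) \<Longrightarrow> height (bs[p := (i, snd (bs ! p))]) < height bs"
  by (intro height_update_less) (auto dest: card_lessThan_mono)

lemma height_column_less:
  "p < length bs \<Longrightarrow> j < snd (bs ! p) \<Longrightarrow> height (bs[p := (fst (bs ! p), j)]) < height bs"
  by (intro height_update_less) (auto dest: card_lessThan_mono)

text \<open>Raised lists have smaller height, so their wedges lie in \<open>W\<close>. Lowering them
  again, summed over all factors, rows and columns, returns a positive multiple of the original
  wedge.\<close>

lemma wedge_mem_if_raised_mem:
  fixes bs :: "('k::{finite,linorder} \<times> 'm::{finite,linorder}) list"
  assumes W: "subspace W"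
    and inv: "\<And>g h x. orthogonal_matrix g \<Longrightarrow> orthogonal_matrix h \<Longrightarrow> x \<in> W
      \<Longrightarrow> ext_map (kron g h) x \<in> W"
    and dist: "distinct bs" and hole: "\<not> order_ideal (set bs)"
    and raised: "\<And>cs. length cs = length bs \<Longrightarrow> height cs < height bs \<Longrightarrow> wedge (axes cs) \<in> W"
  shows "wedge (axes bs) \<in> W"
proof -
  let ?d = "length bs" and ?w = "wedge (axes bs)"
  define r where "r p = fst (bs ! p)" for p
  define c where "c p = snd (bs ! p)" for p
  have bs_nth: "bs ! p = (r p, c p)" for p by (simp add: r_def c_def)
  define X where "X p q = wedge (axes (bs[p := (r q, c p), q := (r p, c q)]))" for p q
  define Y where "Y p q = wedge (axes (bs[p := (r p, c q), q := (r q, c p)]))" for p q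
  have R: "real (card {..<r p}) *\<^sub>R ?w + (\<Sum>q<?d. of_bool (r q < r p) *\<^sub>R X p q) \<in> W"
    if p: "p < ?d" for p
  proof -
    have "wedge (axes (bs[p := (i, c p), q := (i, c q)])) \<in> W"
      if "i < r p" "q < ?d" "q \<noteq> p" "r q = r p" for i q
    proof (rule raised)
      have "height (bs[p := (i, c p), q := (i, c q)]) < height (bs[p := (i, c p)])"
        using height_row_less[of q "bs[p := (i, c p)]" i] that by (simp add: bs_nth)
      also have "\<dots> < height bs" using height_row_less[of p bs i] that p by (simp add: bs_nth)
      finally show "height (bs[p := (i, c p), q := (i, c q)]) < height bs" .
    qed simp
    note raised2 = this
    have "real (card {..<fst (bs ! p)}) *\<^sub>R ?w + (\<Sum>q<?d. of_bool (fst (bs ! q) < fst (bs ! p)) *\<^sub>R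
        wedge (axes (bs[p := (\<lambda>i b. (i, snd b)) (fst (bs ! q)) (bs ! p), q := (\<lambda>i b. (i, snd b)) (fst (bs ! p)) (bs ! q)]))) \<in> W"
    proof (rule lowering_raising_mem[where pr = fst and upd = "\<lambda>i b. (i, snd b)", OF W p])
      show "(\<Sum>q | q < length cs \<and> fst (cs ! q) = i. wedge (axes (cs[q := (\<lambda>i b. (i, snd b)) j (cs ! q)]))) \<in> W"
        if "i \<noteq> j" "wedge (axes cs) \<in> W" "\<And>q. q < length cs \<Longrightarrow> fst (cs ! q) = j
          \<Longrightarrow> wedge (axes (cs[q := (\<lambda>i b. (i, snd b)) i (cs ! q)])) \<in> W" for i j cs
        using that by (intro sum_row_exchange_mem[OF W _ inv]) auto
      show "wedge (axes (bs[p := (\<lambda>i b. (i, snd b)) i (bs ! p)])) \<in> W" if "i < fst (bs ! p)" for i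
        using raised[OF _ height_row_less[OF p that]] by simp
      show "wedge (axes (bs[p := (\<lambda>i b. (i, snd b)) i (bs ! p), q := (\<lambda>i b. (i, snd b)) i (bs ! q)])) \<in> W"
        if "i < fst (bs ! p)" "q < ?d" "q \<noteq> p" "fst (bs ! q) = fst (bs ! p)" for i q
        using raised2[of i q] that by (simp add: bs_nth)
    qed simp_all
    then show ?thesis by (simp add: bs_nth X_def)
  qed
  have C: "real (card {..<c p}) *\<^sub>R ?w + (\<Sum>q<?d. of_bool (c q < c p) *\<^sub>R Y p q) \<in> W"
    if p: "p < ?d" for p
  proof -
    have "wedge (axes (bs[p := (r p, i), q := (r q, i)])) \<in> W"
      if "i < c p" "q < ?d" "q \<noteq> p" "c q = c p" for i q
    proof (rule raised)
      have "height (bs[p := (r p, i), q := (r q, i)]) < height (bs[p := (r p, i)])"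
        using height_column_less[of q "bs[p := (r p, i)]" i] that by (simp add: bs_nth)
      also have "\<dots> < height bs" using height_column_less[of p bs i] that p by (simp add: bs_nth)
      finally show "height (bs[p := (r p, i), q := (r q, i)]) < height bs" .
    qed simp
    note raised2 = this
    have "real (card {..<snd (bs ! p)}) *\<^sub>R ?w + (\<Sum>q<?d. of_bool (snd (bs ! q) < snd (bs ! p)) *\<^sub>R
        wedge (axes (bs[p := (\<lambda>i b. (fst b, i)) (snd (bs ! q)) (bs ! p), q := (\<lambda>i b. (fst b, i)) (snd (bs ! p)) (bs ! q)]))) \<in> W"
    proof (rule lowering_raising_mem[where pr = snd and upd = "\<lambda>i b. (fst b, i)", OF W p])
      show "(\<Sum>q | q < length cs \<and> snd (cs ! q) = i. wedge (axes (cs[q := (\<lambda>i b. (fst b, i)) j (cs ! q)]))) \<in> W"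
        if "i \<noteq> j" "wedge (axes cs) \<in> W" "\<And>q. q < length cs \<Longrightarrow> snd (cs ! q) = j
          \<Longrightarrow> wedge (axes (cs[q := (\<lambda>i b. (fst b, i)) i (cs ! q)])) \<in> W" for i j cs
        using that by (intro sum_column_exchange_mem[OF W _ inv]) auto
      show "wedge (axes (bs[p := (\<lambda>i b. (fst b, i)) i (bs ! p)])) \<in> W" if "i < snd (bs ! p)" for i
        using raised[OF _ height_column_less[OF p that]] by simp
      show "wedge (axes (bs[p := (\<lambda>i b. (fst b, i)) i (bs ! p), q := (\<lambda>i b. (fst b, i)) i (bs ! q)])) \<in> W"
        if "i < snd (bs ! p)" "q < ?d" "q \<noteq> p" "snd (bs ! q) = snd (bs ! p)" for i q
        using raised2[of i q] that by (simp add: bs_nth)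
    qed simp_all
    then show ?thesis by (simp add: bs_nth Y_def)
  qed
  txt \<open>Exchanging both coordinates of two boxes is a transposition of the factors; hence the two
    sums cancel except for pairs of boxes in a common row or column.\<close>
  have Y: "Y p q = - X p q" if "p < ?d" "q < ?d" "p \<noteq> q" for p q
    using wedge_swap[of p "axes (bs[p := (r q, c p), q := (r p, c q)])" q] that
    by (simp add: X_def Y_def map_update list_update_swap[of p q])
  have X_sym: "X p q = X q p" if "p \<noteq> q" for p q
    using that by (simp add: X_def list_update_swap[of p q])
  have X_row: "X p q = ?w" if "r p = r q" for p q
    using that list_update_id[of bs p] list_update_id[of bs q] by (simp add: X_def bs_nth)
  \<comment> \<open>Exchanging the rows of two boxes in one column swaps the boxes entirely, hence
    the sign.\<close>
  have X_column: "X p q = - ?w" if "p < ?d" "q < ?d" "p \<noteq> q" "c p = c q" for p q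
    using wedge_swap[of p "axes bs" q] that
    by (simp add: X_def map_update bs_nth)
  define f where "f p q = of_bool (r q < r p) *\<^sub>R X p q + of_bool (c q < c p) *\<^sub>R Y p q" for p q
  define n where "n p q = of_bool (r q < r p \<and> c q = c p) + (of_bool (c q < c p \<and> r q = r p) :: real)" for p q
  have total: "(\<Sum>p<?d. (real (card {..<r p}) + real (card {..<c p})) *\<^sub>R ?w + (\<Sum>q<?d. f p q)) \<in> W"
  proof (intro subspace_sum[OF W])
    fix p assume "p \<in> {..<?d}"
    then have "p < ?d" by simp
    from subspace_add[OF W R[OF this] C[OF this]]
    show "(real (card {..<r p}) + real (card {..<c p})) *\<^sub>R ?w + (\<Sum>q<?d. f p q) \<in> W"
      by (simp add: f_def sum.distrib scaleR_left_distrib algebra_simps)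
  qed
  \<comment> \<open>If \<open>q\<close> lies above and to the left of \<open>p\<close>, then
    \<open>f p q\<close> vanishes by itself. If it lies above and to the right, \<open>f p q\<close>
    cancels only against \<open>f q p\<close>, which is why symmetrized terms are compared.\<close>
  have "(\<Sum>p<?d. \<Sum>q<?d. f p q) = (\<Sum>p<?d. \<Sum>q<?d. - (n p q *\<^sub>R ?w))"
  proof (rule sum_sum_symmetrize)
    fix p q assume "p \<in> {..<?d}" "q \<in> {..<?d}"
    then have pq: "p < ?d" "q < ?d" by auto
    show "f p q + f q p = - (n p q *\<^sub>R ?w) + - (n q p *\<^sub>R ?w)"
    proof (cases "p = q")
      case True
      then show ?thesis by (simp add: f_def n_def)
    next
      case False
      then have "(r p, c p) \<noteq> (r q, c q)"
        using pq dist by (metis bs_nth nth_eq_iff_index_eq)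
      then show ?thesis
        using False pq Y[of p q] Y[of q p] X_sym[of p q] X_row[of p q] X_column[of p q]
        by (cases "r p" "r q" rule: linorder_cases; cases "c p" "c q" rule: linorder_cases)
           (auto simp: f_def n_def)
    qed
  qed
  then have "(\<Sum>p<?d. (real (card {..<r p}) + real (card {..<c p})) *\<^sub>R ?w + (\<Sum>q<?d. f p q)) =
      (\<Sum>p<?d. real (card {..<r p}) + real (card {..<c p}) - (\<Sum>q<?d. n p q)) *\<^sub>R ?w"
    by (simp add: sum.distrib sum_subtractf sum_negf scaleR_sum_left[symmetric]
        scaleR_left_diff_distrib scaleR_left_distrib)
  with total have N: "(\<Sum>p<?d. real (card {..<r p}) + real (card {..<c p}) - (\<Sum>q<?d. n p q)) *\<^sub>R ?w \<in> W"
    (is "?N *\<^sub>R _ \<in> _") by simp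
  let ?row = "\<lambda>p. {i. i < r p \<and> (i, c p) \<notin> set bs}" and ?col = "\<lambda>p. {j. j < c p \<and> (r p, j) \<notin> set bs}"
  have inj: "inj_on ((!) bs) {..<?d}" using dist by (simp add: inj_on_nth)
  \<comment> \<open>Among the positions above box \<open>p\<close> in its column and left of it in
    its row, \<open>n\<close> counts the occupied ones; distinctness of the boxes makes the count
    exact.\<close>
  have missing: "real (card {..<r p}) + real (card {..<c p}) - (\<Sum>q<?d. n p q) =
      real (card (?row p)) + real (card (?col p))" for p
  proof -
    have "(\<Sum>q<?d. of_bool (r q < r p \<and> c q = c p) :: real) = card {q. q < ?d \<and> r q < r p \<and> c q = c p}"
      by (simp add: sum_of_bool_eq Int_def)
    also have "card {q. q < ?d \<and> r q < r p \<and> c q = c p} = card {i. i < r p \<and> (i, c p) \<in> set bs}"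
    proof (rule bij_betw_same_card[of r])
      show "bij_betw r {q. q < ?d \<and> r q < r p \<and> c q = c p} {i. i < r p \<and> (i, c p) \<in> set bs}"
        using inj unfolding bij_betw_def
        by (auto simp: inj_on_def bs_nth in_set_conv_nth image_def)
    qed
    finally have 1: "(\<Sum>q<?d. of_bool (r q < r p \<and> c q = c p) :: real) = card {i. i < r p \<and> (i, c p) \<in> set bs}" .
    have "(\<Sum>q<?d. of_bool (c q < c p \<and> r q = r p) :: real) = card {q. q < ?d \<and> c q < c p \<and> r q = r p}"
      by (simp add: sum_of_bool_eq Int_def)
    also have "card {q. q < ?d \<and> c q < c p \<and> r q = r p} = card {j. j < c p \<and> (r p, j) \<in> set bs}"
    proof (rule bij_betw_same_card[of c])
      show "bij_betw c {q. q < ?d \<and> c q < c p \<and> r q = r p} {j. j < c p \<and> (r p, j) \<in> set bs}"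
        using inj unfolding bij_betw_def
        by (auto simp: inj_on_def bs_nth in_set_conv_nth image_def)
    qed
    finally have 2: "(\<Sum>q<?d. of_bool (c q < c p \<and> r q = r p) :: real) = card {j. j < c p \<and> (r p, j) \<in> set bs}" .
    have "card {..<r p} = card (?row p \<union> {i. i < r p \<and> (i, c p) \<in> set bs})"
      by (rule arg_cong[of _ _ card]) auto
    also have "\<dots> = card (?row p) + card {i. i < r p \<and> (i, c p) \<in> set bs}"
      by (rule card_Un_disjoint) auto
    finally have 3: "card {..<r p} = \<dots>" .
    have "card {..<c p} = card (?col p \<union> {j. j < c p \<and> (r p, j) \<in> set bs})"
      by (rule arg_cong[of _ _ card]) auto
    also have "\<dots> = card (?col p) + card {j. j < c p \<and> (r p, j) \<in> set bs}"
      by (rule card_Un_disjoint) auto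
    finally have 4: "card {..<c p} = \<dots>" .
    show ?thesis by (simp add: n_def sum.distrib 1 2 3 4)
  qed
  have "\<exists>p<?d. ?row p \<noteq> {} \<or> ?col p \<noteq> {}"
    using hole
  proof (rule not_order_idealE)
    fix i j i' assume "(i, j) \<in> set bs" and *: "i' < i" "(i', j) \<notin> set bs"
    then obtain p where "p < ?d" "r p = i" "c p = j"
      by (metis bs_nth in_set_conv_nth prod.inject)
    then show ?thesis using * by auto
  next
    fix i j j' assume "(i, j) \<in> set bs" and *: "j' < j" "(i, j') \<notin> set bs"
    then obtain p where "p < ?d" "r p = i" "c p = j"
      by (metis bs_nth in_set_conv_nth prod.inject)
    then show ?thesis using * by auto
  qed
  then obtain p where "p < ?d" "card (?row p) > 0 \<or> card (?col p) > 0"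
    by (auto simp: card_gt_0_iff)
  \<comment> \<open>All summands are nonnegative, and the gap makes the one at \<open>p\<close>
    positive.\<close>
  then have "?N > 0" unfolding missing
    by (intro sum_pos2[of _ p]) auto
  with subspace_scale[OF W N, of "inverse ?N"] show ?thesis by simp
qed

section \<open>Orthogonality of the Schubert spans\<close>

lemma det_tensor_eq_0:
  fixes G :: "'k::{finite,linorder} \<Rightarrow> 'k \<Rightarrow> real" and H :: "'m::{finite,linorder} \<Rightarrow> 'm \<Rightarrow> real"
  assumes bs: "distinct bs" "length bs = d" and cs: "length cs = d"
    and ideal: "order_ideal (set bs)"
    and D: "\<And>j j'. j \<in> D \<Longrightarrow> j' \<le> j \<Longrightarrow> j' \<in> D"
    and less: "card {c \<in> set cs. snd c \<notin> D} < card {b \<in> set bs. snd b \<notin> D}"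
  shows "Determinant.det (Matrix.mat d d (\<lambda>(q, p).
    G (fst (cs ! q)) (fst (bs ! p)) * H (snd (cs ! q)) (snd (bs ! p)))) = 0"
    (is "Determinant.det ?M = 0")
proof -
  let ?L = "set bs"
  let ?C = "{c \<in> set cs. snd c \<notin> D}" and ?B = "{b \<in> ?L. snd b \<notin> D}"
  txt \<open>A kernel vector \<open>x\<close> supported on the rows of \<open>L\<close> that contain \<open>D\<close>: the equations \<open>\<phi>\<close> make the
    columns \<open>D\<close> of \<open>x H\<close> vanish, which settles all boxes of \<open>M\<close> with column in \<open>D\<close> at once; the
    equations \<open>\<psi>\<close> settle the others.\<close>
  define I where "I = {i. \<forall>j\<in>D. (i, j) \<in> ?L}"
  define A where "A = {b \<in> ?L. fst b \<in> I}"
  define T :: "(real ^ ('k \<times> 'm)) set" where "T = {x. \<forall>b. b \<notin> A \<longrightarrow> x $ b = 0}"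
  define \<phi> :: "'k \<times> 'm \<Rightarrow> real ^ ('k \<times> 'm)" where
    "\<phi> a = (\<chi> b. if b \<in> A \<and> fst b = fst a then H (snd a) (snd b) else 0)" for a
  define \<psi> :: "'k \<times> 'm \<Rightarrow> real ^ ('k \<times> 'm)" where
    "\<psi> c = (\<chi> b. if b \<in> A then G (fst c) (fst b) * H (snd c) (snd b) else 0)" for c
  define U where "U = \<phi> ` (I \<times> D) \<union> \<psi> ` ?C"
  \<comment> \<open>A box of \<open>L\<close> whose column is not in the initial segment
    \<open>D\<close> lies to the right of all of \<open>D\<close>, so its row contains
    \<open>D\<close>.\<close>
  have "A = I \<times> D \<union> ?B"
    using D order_idealD[OF ideal] by (auto simp: A_def I_def) (metis linear order_refl)+
  moreover have "card (I \<times> D \<union> ?B) = card (I \<times> D) + card ?B"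
    by (rule card_Un_disjoint) auto
  moreover have "card U \<le> card (I \<times> D) + card ?C"
    unfolding U_def by (intro order_trans[OF card_Un_le] add_mono card_image_le) auto
  ultimately have cardU: "card U < card A" using less by simp
  have T: "subspace T" by (auto simp: T_def subspace_def)
  have "T = {x. \<forall>i\<in>Basis. i \<notin> (\<lambda>b. axis b 1) ` A \<longrightarrow> x \<bullet> i = 0}"
    by (auto simp: T_def Basis_vec_def inner_axis axis_eq_axis image_iff)
  then have "dim T = card ((\<lambda>b. axis b (1::real)) ` A)"
    by (simp only:) (rule dim_substandard, auto simp: Basis_vec_def)
  then have dimT: "dim T = card A"
    by (simp add: card_image inj_on_def axis_eq_axis)
  have "U \<subseteq> T" by (auto simp: U_def T_def \<phi>_def \<psi>_def)
  \<comment> \<open>There are fewer equations than the \<open>card A\<close> unknowns, so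
    \<open>U\<close> cannot span \<open>T\<close>, and a nonzero vector of \<open>T\<close>
    orthogonal to \<open>U\<close> solves them all.\<close>
  then have "span U \<subseteq> span T" by (rule span_mono)
  moreover have "dim U \<le> card U" by (rule dim_le_card') (simp add: U_def)
  then have "span U \<noteq> span T" using cardU dimT by (metis dim_span leD)
  ultimately have "span U \<subset> span T" by blast
  then obtain x where x: "x \<noteq> 0" "x \<in> span T" "\<And>y. y \<in> span U \<Longrightarrow> real_inner_class.orthogonal x y"
    by (rule orthogonal_to_subspace_exists_gen) blast
  have xT: "x \<in> T" using x(2) T by (metis span_eq_iff)
  have x0: "x $ b = 0" if "b \<notin> A" for b using xT that unfolding T_def by blast
  have xU: "y \<bullet> x = 0" if "y \<in> U" for y
    using x(3)[OF span_base[OF that]] by (simp add: real_inner_class.orthogonal_def inner_commute)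
  have eqs: "(\<Sum>b\<in>UNIV. G (fst c) (fst b) * H (snd c) (snd b) * x $ b) = 0" if c: "c \<in> set cs" for c
  proof (cases "snd c \<in> D")
    case True
    \<comment> \<open>For \<open>i\<close> in \<open>I\<close> this is one of the equations
      \<open>\<phi>\<close>; in the other rows \<open>x\<close> is zero. Every combination over
      \<open>i\<close> with coefficients from \<open>G\<close> then vanishes too.\<close>
    have "(\<Sum>j\<in>UNIV. H (snd c) j * x $ (i, j)) = 0" for i
    proof (cases "i \<in> I")
      case True
      then have "\<phi> (i, snd c) \<bullet> x = 0" using \<open>snd c \<in> D\<close> by (intro xU) (auto simp: U_def)
      also have "\<phi> (i, snd c) \<bullet> x = (\<Sum>k\<in>UNIV. \<Sum>j\<in>UNIV. if k = i then H (snd c) j * x $ (i, j) else 0)"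
        unfolding inner_vec_def UNIV_Times_UNIV[symmetric] sum.cartesian_product'
        by (intro sum.cong) (auto simp: \<phi>_def x0)
      also have "\<dots> = (\<Sum>k\<in>UNIV. if k = i then \<Sum>j\<in>UNIV. H (snd c) j * x $ (i, j) else 0)"
        by (intro sum.cong) auto
      finally show ?thesis by simp
    next
      case False
      then show ?thesis by (simp add: x0 A_def)
    qed
    then have "(\<Sum>i\<in>UNIV. G (fst c) i * (\<Sum>j\<in>UNIV. H (snd c) j * x $ (i, j))) = 0" by simp
    then show ?thesis
      unfolding UNIV_Times_UNIV[symmetric] sum.cartesian_product'
      by (simp add: sum_distrib_left mult.assoc)
  next
    case False
    then have "\<psi> c \<bullet> x = 0" using c by (intro xU) (auto simp: U_def)
    also have "\<psi> c \<bullet> x = (\<Sum>b\<in>UNIV. G (fst c) (fst b) * H (snd c) (snd b) * x $ b)"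
      unfolding inner_vec_def by (intro sum.cong) (auto simp: \<psi>_def x0)
    finally show ?thesis .
  qed
  let ?v = "Matrix.vec d (\<lambda>p. x $ (bs ! p))"
  have "?M *\<^sub>v ?v = 0\<^sub>v d"
  proof (rule eq_vecI)
    fix q assume "q < dim_vec (0\<^sub>v d :: real Matrix.vec)"
    then have q: "q < d" by simp
    let ?g = "\<lambda>b. G (fst (cs ! q)) (fst b) * H (snd (cs ! q)) (snd b) * x $ b"
    have "vec_index (?M *\<^sub>v ?v) q = (\<Sum>p = 0..<d. ?g (bs ! p))"
      using q by (simp add: scalar_prod_def)
    also have "\<dots> = (\<Sum>b\<in>set bs. ?g b)"
      using bij_betw_nth[OF bs(1) refl refl] bs(2)
      by (intro sum.reindex_bij_betw) (simp add: lessThan_atLeast0)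
    also have "\<dots> = (\<Sum>b\<in>UNIV. ?g b)"
      by (intro sum.mono_neutral_left) (auto simp: x0 A_def)
    also have "\<dots> = 0" using q cs by (intro eqs) auto
    finally show "vec_index (?M *\<^sub>v ?v) q = vec_index (0\<^sub>v d) q" using q by simp
  qed simp
  moreover have "?v \<noteq> 0\<^sub>v d"
  proof -
    obtain b where b: "x $ b \<noteq> 0" using x(1) by (auto simp: Finite_Cartesian_Product.vec_eq_iff)
    then have "b \<in> set bs" using x0[of b] by (auto simp: A_def)
    then obtain p where "p < d" "bs ! p = b" using bs(2) by (auto simp: in_set_conv_nth)
    then have "vec_index ?v p \<noteq> vec_index (0\<^sub>v d) p" using b by simp
    then show ?thesis by metis
  qed
  ultimately have "\<exists>v. v \<in> carrier_vec d \<and> v \<noteq> 0\<^sub>v d \<and> ?M *\<^sub>v v = 0\<^sub>v d"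
    using vec_carrier by blast
  then show ?thesis
    by (simp only: Determinant.det_0_iff_vec_prod_zero_field[OF mat_carrier])
qed

text \<open>The size of column \<open>j\<close> is the drop in the count when \<open>D\<close> grows
  from \<open>{..<j}\<close> to \<open>{..j}\<close>. Columns of order ideals are initial segments,
  hence nested, and nested columns of equal size agree.\<close>

lemma order_ideal_eqI:
  fixes L M :: "('k::{finite,linorder} \<times> 'm::{finite,linorder}) set"
  assumes L: "order_ideal L" and M: "order_ideal M"
    and card: "\<And>D. (\<And>j j'. j \<in> D \<Longrightarrow> j' \<le> j \<Longrightarrow> j' \<in> D) \<Longrightarrow>
      card {b \<in> L. snd b \<notin> D} = card {b \<in> M. snd b \<notin> D}"
  shows "L = M"
proof -
  have "{i. (i, j) \<in> L} = {i. (i, j) \<in> M}" for j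
  proof -
    have column: "card {i. (i, j) \<in> N} = card {b \<in> N. snd b \<notin> {..<j}} - card {b \<in> N. snd b \<notin> {..j}}"
      for N :: "('k \<times> 'm) set"
    proof -
      have "card {i. (i, j) \<in> N} = card ((\<lambda>i. (i, j)) ` {i. (i, j) \<in> N})"
        by (simp add: card_image inj_on_def)
      also have "(\<lambda>i. (i, j)) ` {i. (i, j) \<in> N} = {b \<in> N. snd b \<notin> {..<j}} - {b \<in> N. snd b \<notin> {..j}}"
        by auto
      also have "card \<dots> = card {b \<in> N. snd b \<notin> {..<j}} - card {b \<in> N. snd b \<notin> {..j}}"
        by (rule card_Diff_subset) auto
      finally show ?thesis .
    qed
    have "card {i. (i, j) \<in> L} = card {i. (i, j) \<in> M}"
      unfolding column by (intro arg_cong2[of _ _ _ _ "(-)"] card) auto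
    moreover have "{i. (i, j) \<in> L} \<subseteq> {i. (i, j) \<in> M} \<or> {i. (i, j) \<in> M} \<subseteq> {i. (i, j) \<in> L}"
      using order_idealD[OF L] order_idealD[OF M] by (auto, meson linear order_refl)
    ultimately show ?thesis by (metis card_subset_eq finite)
  qed
  then show ?thesis by auto
qed

lemma ext_map_schubert_vector:
  "ext_map (kron g h) (schubert_vector L) =
    wedge (map (\<lambda>b. (g *v axis (fst b) 1) \<otimes>\<^sub>v (h *v axis (snd b) 1)) (basis_list L))"
  by (simp add: schubert_vector_def ext_map_wedge kron_tensor split_def comp_def)

lemma ext_map_ext_map_schubert_vector:
  "ext_map (kron g h) (ext_map (kron g' h') (schubert_vector L)) =
    ext_map (kron (g ** g') (h ** h')) (schubert_vector L)"
  unfolding ext_map_schubert_vector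
  by (simp add: ext_map_wedge kron_tensor comp_def matrix_vector_mul_assoc)

lemma schubert_vector_eq: "schubert_vector L = axis L 1"
proof -
  have "axis i 1 \<otimes>\<^sub>v axis j 1 = axis (i, j) 1" for i :: 'a and j :: 'b
    by (auto simp: tensor_def Finite_Cartesian_Product.vec_eq_iff axis_nth_if)
  then have "(\<lambda>(i, j). axis i 1 \<otimes>\<^sub>v axis j 1) = (\<lambda>s :: 'a \<times> 'b. axis s 1)"
    by auto
  then show ?thesis by (simp add: schubert_vector_def wedge_basis_list)
qed

lemma inner_schubert_orbits:
  fixes L M :: "('k::{finite,linorder} \<times> 'm::{finite,linorder}) set"
  assumes L: "order_ideal L" and M: "order_ideal M" and card: "card L = card M" and "L \<noteq> M"
  shows "ext_map (kron g h) (schubert_vector L) \<bullet> ext_map (kron g' h') (schubert_vector M) = 0"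
proof -
  \<comment> \<open>The determinant argument is stated for an excess of \<open>L\<close> outside
    \<open>D\<close>; the opposite excess follows by exchanging the roles of \<open>L\<close> and
    \<open>M\<close>.\<close>
  have *: "ext_map (kron g h) (schubert_vector L) \<bullet> ext_map (kron g' h') (schubert_vector M) = 0"
    if L: "order_ideal L" and card: "card L = card M"
      and D: "\<And>j j'. j \<in> D \<Longrightarrow> j' \<le> j \<Longrightarrow> j' \<in> D"
      and less: "card {b \<in> M. snd b \<notin> D} < card {b \<in> L. snd b \<notin> D}"
    for g h g' h' D and L M :: "('k \<times> 'm) set"
  proof -
    let ?bs = "basis_list L" and ?cs = "basis_list M"
    let ?G = "\<lambda>a i. (g' *v axis a 1) \<bullet> (g *v axis i 1)"
    let ?H = "\<lambda>a i. (h' *v axis a 1) \<bullet> (h *v axis i 1)"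
    let ?d = "card L"
    have "ext_map (kron g' h') (schubert_vector M) \<bullet> ext_map (kron g h) (schubert_vector L) =
        Determinant.det (Matrix.mat ?d ?d (\<lambda>(q, p).
          ?G (fst (?cs ! q)) (fst (?bs ! p)) * ?H (snd (?cs ! q)) (snd (?bs ! p))))"
      unfolding ext_map_schubert_vector using card
      by (subst wedge_inner[of _ ?d])
         (auto simp: length_basis_list inner_tensor intro!: arg_cong[of _ _ Determinant.det] eq_matI)
    also have "\<dots> = 0"
    proof (rule det_tensor_eq_0[where D = D])
      show "j' \<in> D" if "j \<in> D" "j' \<le> j" for j j' using that by (rule D)
    qed (use L card less in \<open>simp_all add: basis_list\<close>)
    finally show ?thesis by (simp add: inner_commute)
  qed
  have "\<exists>D. (\<forall>j j'. j \<in> D \<longrightarrow> j' \<le> j \<longrightarrow> j' \<in> D) \<and>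
      card {b \<in> L. snd b \<notin> D} \<noteq> card {b \<in> M. snd b \<notin> D}"
  proof (rule ccontr)
    assume no: "\<not> ?thesis"
    have "L = M" by (rule order_ideal_eqI[OF L M]) (use no in blast)
    with \<open>L \<noteq> M\<close> show False ..
  qed
  then obtain D :: "'m set" where D: "\<And>j j'. j \<in> D \<Longrightarrow> j' \<le> j \<Longrightarrow> j' \<in> D"
    and "card {b \<in> L. snd b \<notin> D} \<noteq> card {b \<in> M. snd b \<notin> D}"
    by blast
  then consider "card {b \<in> M. snd b \<notin> D} < card {b \<in> L. snd b \<notin> D}"
    | "card {b \<in> L. snd b \<notin> D} < card {b \<in> M. snd b \<notin> D}"
    by linarith
  then show ?thesis
  proof cases
    case 1
    show ?thesis by (rule *[OF L card D 1])
  next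
    case 2
    have "ext_map (kron g' h') (schubert_vector M) \<bullet> ext_map (kron g h) (schubert_vector L) = 0"
      by (rule *[OF M card[symmetric] D 2])
    then show ?thesis by (simp add: inner_commute)
  qed
qed

lemma inner_schubert_span:
  fixes L M :: "('k::{finite,linorder} \<times> 'm::{finite,linorder}) set"
  assumes "order_ideal L" "order_ideal M" "card L = card M" "L \<noteq> M"
    and x: "x \<in> schubert_span L" and y: "y \<in> schubert_span M"
  shows "inner x y = 0"
proof -
  have sub: "subspace {u. u \<bullet> v = 0}" for v :: "real ^ (('k \<times> 'm) set)"
    by (auto simp: subspace_def inner_add_left)
  have orbit: "ext_map (kron g h) (schubert_vector L) \<bullet> y = 0" for g h
  proof -
    have "y \<in> {u. u \<bullet> ext_map (kron g h) (schubert_vector L) = 0}"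
      using y unfolding schubert_span_def
      by (rule subsetD[OF span_minimal[OF _ sub], rotated])
         (auto simp: inner_schubert_orbits[OF assms(2,1) assms(3,4)[symmetric]])
    then show ?thesis by (simp add: inner_commute)
  qed
  have "x \<in> {u. u \<bullet> y = 0}"
    using x unfolding schubert_span_def
    by (rule subsetD[OF span_minimal[OF _ sub], rotated]) (auto simp: orbit)
  then show ?thesis by simp
qed

section \<open>The Schubert spans generate\<close>

lemma ext_map_schubert_span:
  assumes g: "orthogonal_matrix g" and h: "orthogonal_matrix h" and x: "x \<in> schubert_span L"
  shows "ext_map (kron g h) x \<in> schubert_span L"
  using x unfolding schubert_span_def
proof (rule span_induct)
  let ?S = "span {ext_map (kron g h) (schubert_vector L) | g h. orthogonal_matrix g \<and> orthogonal_matrix h}"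
  show "subspace {x. ext_map (kron g h) x \<in> ?S}"
    using subspace_span[of "{ext_map (kron g h) (schubert_vector L) | g h. orthogonal_matrix g \<and> orthogonal_matrix h}"]
    by (auto simp: subspace_def linear_0[OF linear_ext_map] linear_add[OF linear_ext_map]
        linear_cmul[OF linear_ext_map])
  show "ext_map (kron g h) x \<in> ?S"
    if gen: "x \<in> {ext_map (kron g h) (schubert_vector L) | g h. orthogonal_matrix g \<and> orthogonal_matrix h}" for x
  proof -
    obtain g' h' where "x = ext_map (kron g' h') (schubert_vector L)"
      "orthogonal_matrix g'" "orthogonal_matrix h'"
      using gen by blast
    moreover have "orthogonal_matrix (g ** g')" "orthogonal_matrix (h ** h')"
      using calculation g h by (simp_all add: orthogonal_matrix_mul)
    ultimately show ?thesis
      by (intro span_base) (auto simp: ext_map_ext_map_schubert_vector)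
  qed
qed

lemma schubert_span_subset_ext_power: "schubert_span L \<subseteq> ext_power (card L)"
proof -
  have "ext_map (kron g h) (schubert_vector L) \<in> ext_power (card L)" for g h
    unfolding ext_map_schubert_vector
    using wedge_in_ext_power[of "map (\<lambda>b. (g *v axis (fst b) 1) \<otimes>\<^sub>v (h *v axis (snd b) 1)) (basis_list L)"]
    by (simp add: length_basis_list)
  then show ?thesis
    unfolding schubert_span_def by (intro span_minimal subspace_ext_power) auto
qed

lemma schubert_vector_mem: "schubert_vector L \<in> schubert_span L"
proof -
  have "kron (Finite_Cartesian_Product.mat 1) (Finite_Cartesian_Product.mat 1) =
      (Finite_Cartesian_Product.mat 1 :: real ^ ('a \<times> 'b) ^ ('a \<times> 'b))"
    by (auto simp: kron_def Finite_Cartesian_Product.mat_def Finite_Cartesian_Product.vec_eq_iff)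
  then have "schubert_vector L = ext_map (kron (Finite_Cartesian_Product.mat 1) (Finite_Cartesian_Product.mat 1)) (schubert_vector L)"
    by (simp add: schubert_vector_def ext_map_wedge comp_def)
  then show ?thesis
    unfolding schubert_span_def by (intro span_base CollectI exI conjI) (assumption, (rule orthogonal_matrix_id)+)
qed

lemma ext_power_subset_span_schubert:
  "(ext_power d :: (real ^ (('k::{finite,linorder} \<times> 'm::{finite,linorder}) set)) set) \<subseteq>
    span (\<Union>L\<in>{L. order_ideal L \<and> card L = d}. schubert_span L)" (is "_ \<subseteq> span ?U")
proof
  have inv: "ext_map (kron g h) x \<in> span ?U"
    if g: "orthogonal_matrix g" and h: "orthogonal_matrix h" and x: "x \<in> span ?U" for g h x
    using x
  proof (rule span_induct)
    show "subspace {x. ext_map (kron g h) x \<in> span ?U}"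
      using subspace_span[of ?U]
      by (auto simp: subspace_def linear_0[OF linear_ext_map] linear_add[OF linear_ext_map]
          linear_cmul[OF linear_ext_map])
  qed (use ext_map_schubert_span[OF g h] in \<open>blast intro: span_base\<close>)
  \<comment> \<open>The induction runs over lists because raising a box may put it on top of another
    one; such wedges are zero.\<close>
  have wedge: "wedge (axes bs) \<in> span ?U" if "length bs = d" for bs :: "('k \<times> 'm) list"
    using that
  proof (induction bs rule: measure_induct_rule[where f = height])
    case (less bs)
    show ?case
    proof (cases "distinct bs")
      case False
      then show ?thesis by (simp add: wedge_axes_repeated span_zero)
    next
      case dist: True
      show ?thesis
      proof (cases "order_ideal (set bs)")
        case True
        then have "axis (set bs) 1 \<in> ?U"
          using schubert_vector_mem[of "set bs"] dist less.prems
          by (auto simp: schubert_vector_eq distinct_card)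
        moreover obtain c where "wedge (axes bs) = c *\<^sub>R axis (set bs) 1"
          using wedge_axes_distinct[OF dist] by blast
        ultimately show ?thesis by (simp only: span_mul span_base)
      next
        case False
        show ?thesis
        proof (rule wedge_mem_if_raised_mem[OF subspace_span inv dist False])
          show "wedge (axes cs) \<in> span ?U" if "length cs = length bs" "height cs < height bs" for cs
            using less.IH[OF that(2)] that(1) less.prems by simp
        qed
      qed
    qed
  qed
  fix x :: "real ^ (('k \<times> 'm) set)" assume x: "x \<in> ext_power d"
  have "(x $ S) *\<^sub>R axis S 1 \<in> span ?U" for S
  proof (cases "card S = d")
    case True
    then have "axis S 1 \<in> span ?U"
      using wedge[of "basis_list S"] by (simp add: wedge_basis_list length_basis_list)
    then show ?thesis by (rule span_mul)
  next
    case False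
    then have "x $ S = 0" using x by (auto simp: ext_power_def)
    then show ?thesis by (simp add: span_zero)
  qed
  then have "(\<Sum>S\<in>UNIV. (x $ S) *\<^sub>R axis S 1) \<in> span ?U"
    by (intro span_sum)
  then show "x \<in> span ?U"
    using basis_expansion[of x] by (simp add: scalar_mult_eq_scaleR)
qed

section \<open>Young diagrams as order ideals\<close>

lemma card_atMost_le: "card {j :: 'm::{finite,linorder}. card {..j} \<le> n} = min n CARD('m)"
proof -
  have inj: "inj (\<lambda>j :: 'm. card {..j})"
  proof (rule injI)
    fix i j :: 'm assume "card {..i} = card {..j}"
    moreover have "{..i} \<subseteq> {..j} \<or> {..j} \<subseteq> {..i}" using linear[of i j] by auto
    ultimately have "{..i} = {..j}" by (metis card_subset_eq finite)
    then show "i = j" by simp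
  qed
  \<comment> \<open>\<open>{..j}\<close> contains \<open>j\<close> itself, so the numbering of
    columns starts at 1 and a row of length \<open>n\<close> consists of the columns numbered 1 to
    \<open>n\<close>.\<close>
  have pos: "card {..j} \<in> {1..CARD('m)}" for j :: 'm
    using card_mono[of UNIV "{..j}"] card_gt_0_iff[of "{..j}"] by auto
  have "range (\<lambda>j :: 'm. card {..j}) = {1..CARD('m)}"
    using pos inj by (intro card_subset_eq) (auto simp: card_image)
  moreover have "(\<lambda>j :: 'm. card {..j}) ` {j. card {..j} \<le> n} = range (\<lambda>j :: 'm. card {..j}) \<inter> {..n}"
    by auto
  moreover have "{1..CARD('m)} \<inter> {..n} = {1..min n CARD('m)}" by auto
  ultimately show ?thesis
    using card_image[OF inj_on_subset[OF inj subset_UNIV], of "{j. card {..j} \<le> n}"] by simp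
qed

lemma young_diagrams_eq:
  "(young_diagrams d :: ('k::{finite,linorder} \<times> 'm::{finite,linorder}) set set) =
    {L. order_ideal L \<and> card L = d}"
proof -
  have card: "card L = (\<Sum>i\<in>UNIV. card {j. (i, j) \<in> L})" for L :: "('k \<times> 'm) set"
  proof -
    have "card (SIGMA i:UNIV. {j. (i, j) \<in> L}) = (\<Sum>i\<in>UNIV. card {j. (i, j) \<in> L})" by simp
    also have "(SIGMA i:UNIV. {j. (i, j) \<in> L}) = L" by auto
    finally show ?thesis .
  qed
  have "order_ideal (diagram p :: ('k \<times> 'm) set)" if "antimono p" for p
    unfolding order_ideal_def diagram_def
  proof clarify
    fix i i' :: 'k and j j' :: 'm
    assume *: "card {..j} \<le> p i" "i' \<le> i" "j' \<le> j"
    have "card {..j'} \<le> card {..j}" using * by (intro card_mono) auto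
    also have "\<dots> \<le> p i'" using * antimonoD[OF that \<open>i' \<le> i\<close>] by simp
    finally show "card {..j'} \<le> p i'" .
  qed
  moreover have "card (diagram p :: ('k \<times> 'm) set) = (\<Sum>i\<in>UNIV. p i)"
    if "\<forall>i. p i \<le> CARD('m)" for p
    using that by (simp add: card diagram_def card_atMost_le)
  moreover have "\<exists>p. L = diagram p \<and> antimono p \<and> (\<forall>i. p i \<le> CARD('m)) \<and> (\<Sum>i\<in>UNIV. p i) = d"
    if L: "order_ideal L" "card L = d" for L :: "('k \<times> 'm) set"
  proof (intro exI conjI allI)
    \<comment> \<open>The partition is recovered from the row lengths.\<close>
    let ?p = "\<lambda>i. card {j. (i, j) \<in> L}"
    show "antimono ?p"
      using order_idealD[OF L(1)] by (intro antimonoI card_mono) auto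
    show "?p i \<le> CARD('m)" for i by (intro card_mono) auto
    show "(\<Sum>i\<in>UNIV. ?p i) = d" using L(2) card by simp
    have "(i, j) \<in> L \<longleftrightarrow> card {..j} \<le> ?p i" for i j
    proof
      assume "(i, j) \<in> L"
      then show "card {..j} \<le> ?p i"
        using order_idealD[OF L(1)] by (intro card_mono) auto
    next
      assume le: "card {..j} \<le> ?p i"
      show "(i, j) \<in> L"
      proof (rule ccontr)
        assume "(i, j) \<notin> L"
        \<comment> \<open>Rows are initial segments, so a row that misses \<open>j\<close> ends
          before \<open>j\<close> and is too short.\<close>
        then have "{j'. (i, j') \<in> L} \<subset> {..j}"
          using order_idealD[OF L(1)] by (auto, meson linear order_refl)
        then show False using le psubset_card_mono[OF finite] by (metis leD)
      qed
    qed
    then show "L = diagram ?p" unfolding diagram_def by blast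
  qed
  ultimately show ?thesis unfolding young_diagrams_def by blast
qed

section \<open>From orthogonality and spanning to unique decompositions\<close>

lemma orthogonal_decompositionI:
  fixes V :: "'i \<Rightarrow> 'v::real_inner set"
  assumes I: "finite I" and V: "\<And>i. i \<in> I \<Longrightarrow> subspace (V i)" "\<And>i. i \<in> I \<Longrightarrow> V i \<subseteq> W"
    and orth: "\<And>i j x y. i \<in> I \<Longrightarrow> j \<in> I \<Longrightarrow> i \<noteq> j \<Longrightarrow> x \<in> V i \<Longrightarrow> y \<in> V j \<Longrightarrow> inner x y = 0"
    and span: "W \<subseteq> span (\<Union>i\<in>I. V i)"
  shows "orthogonal_decomposition W I V"
proof -
  \<comment> \<open>Existence: \<open>T\<close> is a subspace containing every \<open>V i\<close>,
    hence the whole span. Families are cut off by \<open>restrict\<close> because members of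
    \<open>PiE I V\<close> are \<open>undefined\<close> outside \<open>I\<close>.\<close>
  define T where "T = {\<Sum>i\<in>I. x i | x. x \<in> PiE I V}"
  have "subspace T"
  proof (rule subspaceI)
    have "restrict (\<lambda>_. 0) I \<in> PiE I V" using subspace_0 V by auto
    moreover have "(\<Sum>i\<in>I. restrict (\<lambda>_. 0) I i) = (0 :: 'v)" by (simp add: sum.neutral)
    ultimately show "0 \<in> T" unfolding T_def mem_Collect_eq by metis
  next
    fix u v assume "u \<in> T" "v \<in> T"
    then obtain x y where xy: "x \<in> PiE I V" "y \<in> PiE I V" "u = (\<Sum>i\<in>I. x i)" "v = (\<Sum>i\<in>I. y i)"
      by (auto simp: T_def)
    have "x i + y i \<in> V i" if "i \<in> I" for i
      using xy that V(1) by (intro subspace_add) auto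
    then have "restrict (\<lambda>i. x i + y i) I \<in> PiE I V" by auto
    moreover have "u + v = (\<Sum>i\<in>I. restrict (\<lambda>i. x i + y i) I i)" using xy by (simp add: sum.distrib)
    ultimately show "u + v \<in> T" unfolding T_def by blast
  next
    fix c u assume "u \<in> T"
    then obtain x where x: "x \<in> PiE I V" "u = (\<Sum>i\<in>I. x i)" by (auto simp: T_def)
    have "c *\<^sub>R x i \<in> V i" if "i \<in> I" for i
      using x that V(1) by (intro subspace_scale) auto
    then have "restrict (\<lambda>i. c *\<^sub>R x i) I \<in> PiE I V" by auto
    moreover have "c *\<^sub>R u = (\<Sum>i\<in>I. restrict (\<lambda>i. c *\<^sub>R x i) I i)" using x by (simp add: scaleR_sum_right)
    ultimately show "c *\<^sub>R u \<in> T" unfolding T_def by blast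
  qed
  moreover have "V i \<subseteq> T" if i: "i \<in> I" for i
  proof
    fix v assume v: "v \<in> V i"
    have "restrict (\<lambda>j. if j = i then v else 0) I \<in> PiE I V"
      using v subspace_0[OF V(1)] by auto
    moreover have "(\<Sum>j\<in>I. restrict (\<lambda>j. if j = i then v else 0) I j) = v" using i I by simp
    ultimately show "v \<in> T" unfolding T_def mem_Collect_eq by metis
  qed
  ultimately have "W \<subseteq> T" using span span_minimal[of "\<Union>i\<in>I. V i" T] by blast
  moreover have "x = y"
    if x: "x \<in> PiE I V" and y: "y \<in> PiE I V" and eq: "(\<Sum>i\<in>I. x i) = (\<Sum>i\<in>I. y i)" for x y
  proof (rule PiE_ext[OF x y])
    fix i assume i: "i \<in> I"
    have mem: "x j - y j \<in> V j" if "j \<in> I" for j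
      using x y that V(1) by (intro subspace_diff) auto
    \<comment> \<open>Uniqueness: pairing the zero difference of two representations with its own
      component at \<open>i\<close> leaves the squared norm of that component.\<close>
    have "0 = (\<Sum>j\<in>I. x j - y j) \<bullet> (x i - y i)" using eq by (simp add: sum_subtractf)
    also have "\<dots> = (\<Sum>j\<in>I. if j = i then (x i - y i) \<bullet> (x i - y i) else 0)"
      unfolding inner_sum_left using i mem by (intro sum.cong) (auto intro: orth)
    also have "\<dots> = (x i - y i) \<bullet> (x i - y i)" using i I by simp
    finally show "x i = y i" by simp
  qed
  ultimately show ?thesis
    unfolding orthogonal_decomposition_def using V orth by (auto simp: T_def)
qed

theorem theorem8p18:
  fixes d :: nat
  assumes "d \<le> CARD('k::{finite,linorder}) * CARD('m::{finite,linorder})"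
  shows "orthogonal_decomposition
    (ext_power d :: (real ^ (('k \<times> 'm) set)) set) (young_diagrams d) schubert_span"
proof (rule orthogonal_decompositionI)
  show "schubert_span L \<subseteq> ext_power d" if "L \<in> young_diagrams d" for L :: "('k \<times> 'm) set"
    using that schubert_span_subset_ext_power[of L] by (simp add: young_diagrams_eq)
  show "inner x y = 0" if "L \<in> young_diagrams d" "M \<in> young_diagrams d" "L \<noteq> M"
    "x \<in> schubert_span L" "y \<in> schubert_span M" for L M :: "('k \<times> 'm) set" and x y
    using that inner_schubert_span[of L M x y] by (simp add: young_diagrams_eq)
  show "ext_power d \<subseteq> span (\<Union>L\<in>young_diagrams d :: ('k \<times> 'm) set set. schubert_span L)"
    unfolding young_diagrams_eq by (rule ext_power_subset_span_schubert)
qed (simp_all add: schubert_span_def)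

end
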